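(* Let $1\le q<\infty$ and $p>0$. If $p<q$, then $\exp L_p\in F_q$. If $p>q$, then $\exp L_p\notin F_q$.
   Context: $\exp L_p$ is the Orlicz space on $[0,1]$ generated by $M_p(u)=e^{|u|^p}-1$, i.e. the space of measurable $x$ for which $\|x\|=\inf\{\lambda>0:\int_0^1M_p(|x(t)|/\lambda)\,dt\le1\}$ is finite; when $0<p<1$, $M_p$ is convex only for large $u$, and $M_p$ is replaced by an equivalent convex function (this gives the same space up to equivalence of norms). For a real $n\times n$ matrix $x=(x_{ij})$, $x_1^*\ge x_2^*\ge\dots\ge x_{n^2}^*$ is the decreasing rearrangement of the numbers $|x_{ij}|$. Let $S_n$ be the group of permutations of $\{1,\dots,n\}$ and $\ell:S_n\to\{1,\dots,n!\}$ a bijection. For $1\le q<\infty$ define the step function on $[0,1)$ $$T_qx(t)=\Big(\sum_{i=1}^n|x_{i,\pi(i)}|^q\Big)^{1/q},\qquad t\in\Big[\tfrac{\ell(\pi)-1}{n!},\tfrac{\ell(\pi)}{n!}\Big),$$ and $Ux(t)=\sum_{k=1}^n x_k^*\chi_{((k-1)/n,k/n)}(t)$. For a rearrangement invariant space $E$ on $[0,1]$, $\|T_qx\|_E$ does not depend on $\ell$. $F_q$ is the set of rearrangement invariant spaces $E$ on $[0,1]$ such that $$\|T_qx\|_E\approx\|Ux\|_E+\Big(\frac1n\sum_{k=n+1}^{n^2}(x_k^* )^q\Big)^{1/q}$$ for all $n$ and all real $n\times n$ matrices $x$, with equivalence constants independent of $x$ and $n$. *)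

theory Defs
  imports "HOL-Analysis.Analysis" "HOL-Combinatorics.Permutations"
    "HOL-Real_Asymp.Real_Asymp"
begin

text \<open>Function spaces on the unit interval. Elements are functions on the reals of which only the
  restriction to the unit interval matters; functions equal almost everywhere there are not
  identified, so norms are definite only up to null sets.\<close>

abbreviation unit_leb :: "real measure" where
  "unit_leb \<equiv> lebesgue_on {0..1}"

record fspace =
  elems :: "(real \<Rightarrow> real) set"
  fnorm :: "(real \<Rightarrow> real) \<Rightarrow> real"

definition banach_fspace :: "fspace \<Rightarrow> bool" where
  "banach_fspace E \<longleftrightarrow>
     elems E \<subseteq> borel_measurable unit_leb \<and>
     (\<lambda>t. 0) \<in> elems E \<and>
     (\<forall>x\<in>elems E. \<forall>y\<in>elems E. (\<lambda>t. x t + y t) \<in> elems E \<and>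
        fnorm E (\<lambda>t. x t + y t) \<le> fnorm E x + fnorm E y) \<and>
     (\<forall>x\<in>elems E. \<forall>a. (\<lambda>t. a * x t) \<in> elems E \<and>
        fnorm E (\<lambda>t. a * x t) = \<bar>a\<bar> * fnorm E x) \<and>
     (\<forall>x\<in>elems E. 0 \<le> fnorm E x \<and> (fnorm E x = 0 \<longleftrightarrow> (AE t in unit_leb. x t = 0))) \<and>
     (\<forall>f :: nat \<Rightarrow> real \<Rightarrow> real.
        (\<forall>m. f m \<in> elems E) \<and>
        (\<forall>\<epsilon>>0. \<exists>N. \<forall>m\<ge>N. \<forall>k\<ge>N. fnorm E (\<lambda>t. f m t - f k t) < \<epsilon>) \<longrightarrow>
        (\<exists>g\<in>elems E. (\<lambda>m. fnorm E (\<lambda>t. f m t - g t)) \<longlonglongrightarrow> 0))"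

definition equimeasurable :: "(real \<Rightarrow> real) \<Rightarrow> (real \<Rightarrow> real) \<Rightarrow> bool" where
  "equimeasurable x y \<longleftrightarrow>
     (\<forall>\<tau>>0. measure unit_leb {t \<in> {0..1}. \<bar>x t\<bar> > \<tau>} = measure unit_leb {t \<in> {0..1}. \<bar>y t\<bar> > \<tau>})"

definition ri_space :: "fspace \<Rightarrow> bool" where
  "ri_space E \<longleftrightarrow>
     banach_fspace E \<and>
     (\<exists>x\<in>elems E. fnorm E x \<noteq> 0) \<and>
     (\<forall>x\<in>borel_measurable unit_leb. \<forall>y\<in>elems E.
        (AE t in unit_leb. \<bar>x t\<bar> \<le> \<bar>y t\<bar>) \<longrightarrow> x \<in> elems E \<and> fnorm E x \<le> fnorm E y) \<and>
     (\<forall>x\<in>borel_measurable unit_leb. \<forall>y\<in>elems E.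
        equimeasurable x y \<longrightarrow> x \<in> elems E \<and> fnorm E x = fnorm E y)"

definition orlicz_modular :: "(real \<Rightarrow> real) \<Rightarrow> (real \<Rightarrow> real) \<Rightarrow> ennreal" where
  "orlicz_modular M x = (\<integral>\<^sup>+t. ennreal (M \<bar>x t\<bar>) \<partial>unit_leb)"

definition orlicz_space :: "(real \<Rightarrow> real) \<Rightarrow> fspace" where
  "orlicz_space M =
     \<lparr>elems = {x \<in> borel_measurable unit_leb. \<exists>r>0. orlicz_modular M (\<lambda>t. x t / r) \<le> 1},
      fnorm = (\<lambda>x. Inf {r. r > 0 \<and> orlicz_modular M (\<lambda>t. x t / r) \<le> 1})\<rparr>"

definition M_exp :: "real \<Rightarrow> real \<Rightarrow> real" where
  "M_exp p u = exp (\<bar>u\<bar> powr p) - 1"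

definition convex_orlicz_function :: "(real \<Rightarrow> real) \<Rightarrow> bool" where
  "convex_orlicz_function M \<longleftrightarrow> M 0 = 0 \<and> mono_on {0..} M \<and> convex_on {0..} M"

text \<open>On a finite measure space only the behaviour at infinity matters; for \<open>p < 1\<close> no convex
  function vanishing at \<open>0\<close> is comparable with \<open>M_exp p\<close> near \<open>0\<close>.\<close>

definition equivalent_at_infinity :: "(real \<Rightarrow> real) \<Rightarrow> (real \<Rightarrow> real) \<Rightarrow> bool" where
  "equivalent_at_infinity M N \<longleftrightarrow>
     (\<exists>a>0. \<exists>b>0. \<exists>u\<^sub>0. \<forall>u\<ge>u\<^sub>0. N (a * u) \<le> M u \<and> M u \<le> N (b * u))"

text \<open>The functions generating the space \<open>exp L\<^sub>p\<close>: the function \<open>M_exp p\<close> itself if it is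
  convex, and otherwise an arbitrary equivalent convex function.\<close>

definition generates_exp_L :: "real \<Rightarrow> (real \<Rightarrow> real) \<Rightarrow> bool" where
  "generates_exp_L p M \<longleftrightarrow>
     (if p \<ge> 1 then M = M_exp p
      else convex_orlicz_function M \<and> equivalent_at_infinity M (M_exp p))"

text \<open>An \<open>n \<times> n\<close> matrix is a function of two indices, used only on \<open>{1..n} \<times> {1..n}\<close>.\<close>

definition decr_rearr :: "nat \<Rightarrow> (nat \<Rightarrow> nat \<Rightarrow> real) \<Rightarrow> nat \<Rightarrow> real" where
  "decr_rearr n x k = rev (sort [\<bar>x i j\<bar>. i \<leftarrow> [1..<n+1], j \<leftarrow> [1..<n+1]]) ! (k - 1)"

definition T_op ::
    "real \<Rightarrow> nat \<Rightarrow> ((nat \<Rightarrow> nat) \<Rightarrow> nat) \<Rightarrow> (nat \<Rightarrow> nat \<Rightarrow> real) \<Rightarrow> real \<Rightarrow> real" where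
  "T_op q n l x t =
     (\<Sum>\<pi> | \<pi> permutes {1..n}.
        (\<Sum>i=1..n. \<bar>x i (\<pi> i)\<bar> powr q) powr (1 / q) *
        indicator {(real (l \<pi>) - 1) / fact n ..< real (l \<pi>) / fact n} t)"

definition U_op :: "nat \<Rightarrow> (nat \<Rightarrow> nat \<Rightarrow> real) \<Rightarrow> real \<Rightarrow> real" where
  "U_op n x t =
     (\<Sum>k=1..n. decr_rearr n x k * indicator {(real k - 1) / real n <..< real k / real n} t)"

definition F_class :: "real \<Rightarrow> fspace set" where
  "F_class q = {E. ri_space E \<and>
     (\<exists>c>0. \<exists>C>0. \<forall>n\<ge>1. \<forall>l x.
        bij_betw l {\<pi>. \<pi> permutes {1..n}} {1..fact n} \<longrightarrow>
        (let R = fnorm E (U_op n x) +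
               ((\<Sum>k=n+1..n^2. decr_rearr n x k powr q) / real n) powr (1 / q)
         in c * R \<le> fnorm E (T_op q n l x) \<and> fnorm E (T_op q n l x) \<le> C * R))}"

text \<open>The defining condition of \<open>exp L\<^sub>p\<close> is satisfiable also for \<open>p < 1\<close>: shift the exponential
  to the right of its inflection point.\<close>

lemma ex_generates_exp_L:
  assumes "p > 0"
  shows "\<exists>M. generates_exp_L p M"
proof (cases "p \<ge> 1")
  case True
  then show ?thesis by (auto simp: generates_exp_L_def)
next
  case False
  define v where "v = (1 / p) powr (1 / p)"
  have v: "v > 0" "v powr p = 1 / p"
    using assms by (auto simp: v_def powr_powr)
  define M where "M u = exp ((u + v) powr p) - exp (v powr p)" for u
  have "convex_on {0..} (\<lambda>u. exp ((u + v) powr p) - exp (v powr p))"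
  proof (rule f''_ge0_imp_convex)
    fix u :: real assume "u \<in> {0..}"
    then have u: "u + v > 0" "u \<ge> 0" using v by auto
    show "((\<lambda>u. exp ((u + v) powr p) - exp (v powr p)) has_real_derivative
        exp ((u + v) powr p) * (p * (u + v) powr (p - 1))) (at u)"
      using u by (auto intro!: derivative_eq_intros)
    show "((\<lambda>u. exp ((u + v) powr p) * (p * (u + v) powr (p - 1))) has_real_derivative
        exp ((u + v) powr p) * (p * (u + v) powr (p - 1)) * (p * (u + v) powr (p - 1)) +
        exp ((u + v) powr p) * (p * ((p - 1) * (u + v) powr (p - 2)))) (at u)"
      using u by (auto intro!: derivative_eq_intros simp: algebra_simps)
    have "(u + v) powr p \<ge> v powr p" using u v assms by (intro powr_mono2) auto
    then have "p * (u + v) powr p \<ge> 1" using v assms by (simp add: field_simps)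
    then have "0 \<le> p * (p * (u + v) powr p + (p - 1)) * (u + v) powr (p - 2)"
      using assms by (intro mult_nonneg_nonneg) auto
    also have "\<dots> = p * (u + v) powr (p - 1) * (p * (u + v) powr (p - 1)) +
        p * ((p - 1) * (u + v) powr (p - 2))"
      using u by (simp add: algebra_simps flip: powr_add)
    finally have "0 \<le> exp ((u + v) powr p) * (p * (u + v) powr (p - 1) * (p * (u + v) powr (p - 1)) +
        p * ((p - 1) * (u + v) powr (p - 2)))" by (intro mult_nonneg_nonneg) auto
    then show "0 \<le> exp ((u + v) powr p) * (p * (u + v) powr (p - 1)) * (p * (u + v) powr (p - 1)) +
        exp ((u + v) powr p) * (p * ((p - 1) * (u + v) powr (p - 2)))"
      by (simp add: algebra_simps)
  qed auto
  moreover have "mono_on {0..} M"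
    unfolding M_def using v assms by (auto intro!: mono_onI powr_mono2)
  ultimately have "convex_orlicz_function M"
    by (simp add: convex_orlicz_function_def M_def[abs_def])
  moreover have "equivalent_at_infinity M (M_exp p)"
  proof -
    let ?f = "\<lambda>u::real. exp (u powr p) - exp (v powr p) - (exp ((u / 2) powr p) - 1)"
    define a :: real where "a = (1 / 2) powr p"
    have a: "a > 0" "a < 1" using assms powr_less_mono2[of p "1/2" 1] by (auto simp: a_def)
    have "filterlim (\<lambda>u::real. u powr p) at_top at_top"
      using assms by real_asymp
    then have "filterlim (\<lambda>u::real. (1 - a) * u powr p) at_top at_top"
      using a by (intro filterlim_tendsto_pos_mult_at_top[OF tendsto_const]) auto
    then have "eventually (\<lambda>u. (1 - a) * u powr p \<ge> exp (v powr p)) at_top"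
      by (auto simp: filterlim_at_top)
    then have "eventually (\<lambda>u. ?f u \<ge> 0) at_top"
      using eventually_gt_at_top[of 0]
    proof eventually_elim
      case (elim u)
      let ?y = "u powr p"
      have e: "(u / 2) powr p = a * ?y" using elim by (simp add: a_def powr_divide)
      have "(1 - a) * ?y \<le> exp ((1 - a) * ?y) - 1"
        using exp_ge_add_one_self[of "(1 - a) * ?y"] unfolding le_diff_eq by (simp only: add.commute)
      also have "\<dots> = 1 * (exp ((1 - a) * ?y) - 1)" by simp
      also have "\<dots> \<le> exp (a * ?y) * (exp ((1 - a) * ?y) - 1)"
        using a by (intro mult_right_mono) auto
      also have "\<dots> = exp ?y - exp (a * ?y)"
        by (simp add: algebra_simps flip: exp_add)
      finally show ?case using elim e by simp
    qed
    then obtain w where w: "\<And>u. u \<ge> w \<Longrightarrow> ?f u \<ge> 0" by (auto simp: eventually_at_top_linorder)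
    have "M_exp p (1/2 * u) \<le> M u \<and> M u \<le> M_exp p (2 * u)" if "u \<ge> max w v" for u
    proof
      have u: "u \<ge> w" "u \<ge> v" "u > 0" using that v by auto
      have "exp (u powr p) \<le> exp ((u + v) powr p)" using u v assms by (auto intro!: powr_mono2)
      moreover have "exp ((u / 2) powr p) - 1 \<le> exp (u powr p) - exp (v powr p)"
        using w[OF u(1)] by simp
      ultimately have "exp ((u / 2) powr p) - 1 \<le> exp ((u + v) powr p) - exp (v powr p)"
        by (meson diff_right_mono order_trans)
      then show "M_exp p (1/2 * u) \<le> M u" using u by (simp add: M_exp_def M_def)
      have "exp ((u + v) powr p) \<le> exp ((2 * u) powr p)" using u v assms by (auto intro!: powr_mono2)
      moreover have "1 \<le> exp (v powr p)" by simp
      ultimately have "exp ((u + v) powr p) - exp (v powr p) \<le> exp ((2 * u) powr p) - 1"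
        by (rule diff_mono)
      then show "M u \<le> M_exp p (2 * u)" using u by (simp add: M_exp_def M_def)
    qed
    then show ?thesis unfolding equivalent_at_infinity_def
      by (intro exI[of _ "1/2"] exI[of _ 2] exI[of _ "max w v"] conjI) auto
  qed
  ultimately show ?thesis using False by (auto simp: generates_exp_L_def)
qed

end

theory Submission
  imports Defs
begin

text \<open>For a random permutation \<open>\<pi>\<close> and \<open>c\<^sub>i\<^sub>j \<ge> 0\<close>, expanding the product and using
  \<open>(n - k)! / n! \<le> (e / n)\<^sup>k\<close> gives \<open>\<bbbE> (\<Prod>i. 1 + c\<^sub>i\<^sub>\<pi>\<^sub>(\<^sub>i\<^sub>)) \<le> exp (e / n \<cdot> \<Sum>ij. c\<^sub>i\<^sub>j)\<close>. As
  \<open>u \<mapsto> u powr (p / q)\<close> is subadditive for \<open>p < q\<close>, the quantity \<open>exp ((T\<^sub>q x) powr p)\<close> is dominated by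
  such a product, in which the \<open>n\<close> largest entries contribute the modular of \<open>U x\<close> and the others
  their \<open>\<ell>\<^sub>q\<close> sum; this is the upper estimate. For the lower one, \<open>T\<^sub>q x\<close> dominates the largest entry
  met by \<open>\<pi>\<close>, whose tails are comparable with those of \<open>U x\<close> by the second moment method, and the
  \<open>q\<close>-th moment of \<open>T\<^sub>q x\<close> is exactly the normalised \<open>\<ell>\<^sub>q\<close> sum of all entries. For \<open>q < p\<close> the
  identity matrices are counterexamples.\<close>

subsection \<open>Random permutations\<close>

text \<open>The values \<open>\<pi> i\<close> are dependent, so moments of \<open>T_op\<close> do
  not factorise over the rows. The product bound shows that this dependence costs only a factor e in
  the exponent, and its right-hand side is a sum over all entries, hence sees the matrix only
  through \<open>decr_rearr\<close>. The exponential of \<open>T_val\<close> to the power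
  \<open>p\<close> must therefore be bounded by a product over rows. Plain subadditivity of
  \<open>z powr s\<close>, \<open>s = p / q\<close>, would give one but loses too much: many small
  entries can have a large sum of \<open>z powr s\<close> and a small sum of \<open>z\<close>.
  Adding 1 before taking the power repairs this at the cost of a factor e, because beyond 1 the
  power has slope at most 1; each entry then counts as the smaller of \<open>z\<close> and
  \<open>z powr s\<close>.

  Both estimates compare modulars, up to constants: by convexity, a modular bounded by
  \<open>K \<ge> 1\<close> at scale \<open>r\<close> gives a norm bounded by \<open>K * r\<close>.
  So additive constants in the comparison of \<open>M\<close> with exponentials are harmless, and
  the convex substitutes for \<open>p < 1\<close> fit the same scheme as
  \<open>M_exp p\<close>.\<close>

lemma card_permutes_extending_le:
  assumes "finite S" "I \<subseteq> S"
  shows "card {\<pi>. \<pi> permutes S \<and> (\<forall>i\<in>I. \<pi> i = f i)} \<le> fact (card S - card I)"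
proof (cases "{\<pi>. \<pi> permutes S \<and> (\<forall>i\<in>I. \<pi> i = f i)} = {}")
  case True
  show ?thesis unfolding True by simp
next
  case False
  then obtain \<rho> where \<rho>: "\<rho> permutes S" "\<And>i. i \<in> I \<Longrightarrow> \<rho> i = f i" by blast
  have fin: "finite (S - I)" using assms by simp
  \<comment> \<open>\<open>\<rho>\<close> is one permutation with the prescribed values; composing
    with its inverse turns the prescription into fixing \<open>I\<close> pointwise. Equality may
    fail in general: if \<open>f\<close> is not injective on \<open>I\<close> or leaves
    \<open>S\<close>, there is no such permutation.\<close>
  have "card {\<pi>. \<pi> permutes S \<and> (\<forall>i\<in>I. \<pi> i = f i)} \<le> card {\<sigma>. \<sigma> permutes (S - I)}"
  proof (rule card_inj_on_le[of "\<lambda>\<pi>. inv \<rho> \<circ> \<pi>"])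
    show "inj_on (\<lambda>\<pi>. inv \<rho> \<circ> \<pi>) {\<pi>. \<pi> permutes S \<and> (\<forall>i\<in>I. \<pi> i = f i)}"
    proof (rule inj_onI)
      fix \<pi> \<pi>' assume "inv \<rho> \<circ> \<pi> = inv \<rho> \<circ> \<pi>'"
      then have "\<rho> \<circ> (inv \<rho> \<circ> \<pi>) = \<rho> \<circ> (inv \<rho> \<circ> \<pi>')" by simp
      then show "\<pi> = \<pi>'" using permutes_inv_o(1)[OF \<rho>(1)] by (simp add: o_assoc)
    qed
    show "(\<lambda>\<pi>. inv \<rho> \<circ> \<pi>) ` {\<pi>. \<pi> permutes S \<and> (\<forall>i\<in>I. \<pi> i = f i)} \<subseteq> {\<sigma>. \<sigma> permutes (S - I)}"
    proof (clarify)
      fix \<pi> assume \<pi>: "\<pi> permutes S" "\<forall>i\<in>I. \<pi> i = f i"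
      have "inv \<rho> \<circ> \<pi> permutes S"
        using \<pi>(1) \<rho>(1) by (intro permutes_compose permutes_inv)
      then show "inv \<rho> \<circ> \<pi> permutes (S - I)"
      proof (rule permutes_superset)
        fix x assume "x \<in> S - (S - I)"
        then have "x \<in> I" by blast
        then have "\<pi> x = \<rho> x" using \<pi>(2) \<rho>(2) by simp
        then show "(inv \<rho> \<circ> \<pi>) x = x" by (simp add: permutes_inverses[OF \<rho>(1)])
      qed
    qed
    show "finite {\<sigma>. \<sigma> permutes (S - I)}" using fin by (rule finite_permutations)
  qed
  also have "\<dots> = fact (card S - card I)"
    using assms by (subst card_permutations[OF _ fin]) (auto simp: card_Diff_subset finite_subset)
  finally show ?thesis .
qed

text \<open>Permutations are grouped by their restriction to \<open>I\<close>. Since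
  \<open>c\<close> is nonnegative, the restrictions may be enlarged to all functions from
  \<open>I\<close> to \<open>S\<close>, injective or not, and over these the product
  factorises.\<close>

lemma sum_permutes_prod_le:
  fixes c :: "'a \<Rightarrow> 'a \<Rightarrow> real"
  assumes "finite S" "I \<subseteq> S" and nn: "\<And>i j. c i j \<ge> 0"
  shows "(\<Sum>\<pi> | \<pi> permutes S. \<Prod>i\<in>I. c i (\<pi> i))
    \<le> fact (card S - card I) * (\<Prod>i\<in>I. \<Sum>j\<in>S. c i j)"
proof -
  have finI: "finite I" using assms finite_subset by blast
  let ?P = "{\<pi>. \<pi> permutes S}"
  let ?F = "PiE I (\<lambda>_. S)"
  have finP: "finite ?P" using assms by (intro finite_permutations)
  have finF: "finite ?F" using assms finI by (intro finite_PiE) auto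
  have im: "(\<lambda>\<pi>. restrict \<pi> I) ` ?P \<subseteq> ?F"
  proof (rule image_subsetI)
    fix \<pi> assume "\<pi> \<in> ?P"
    then have "\<pi> i \<in> S" if "i \<in> I" for i
      using that assms(2) permutes_in_image[of \<pi> S i] by blast
    then show "restrict \<pi> I \<in> ?F" by (simp add: restrict_PiE_iff)
  qed
  have "(\<Sum>\<pi>\<in>?P. \<Prod>i\<in>I. c i (\<pi> i)) =
      (\<Sum>f\<in>?F. \<Sum>\<pi>\<in>{\<pi>. \<pi> \<in> ?P \<and> restrict \<pi> I = f}. \<Prod>i\<in>I. c i (\<pi> i))"
    by (rule sum.group[OF finP finF im, symmetric])
  also have "\<dots> \<le> (\<Sum>f\<in>?F. fact (card S - card I) * (\<Prod>i\<in>I. c i (f i)))"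
  proof (rule sum_mono)
    fix f assume f: "f \<in> ?F"
    have sub: "{\<pi>. \<pi> \<in> ?P \<and> restrict \<pi> I = f} \<subseteq> {\<pi>. \<pi> permutes S \<and> (\<forall>i\<in>I. \<pi> i = f i)}"
      by auto
    have "finite {\<pi>. \<pi> permutes S \<and> (\<forall>i\<in>I. \<pi> i = f i)}"
      using finP by (rule rev_finite_subset) auto
    then have "card {\<pi>. \<pi> \<in> ?P \<and> restrict \<pi> I = f} \<le> fact (card S - card I)"
      using card_mono[OF _ sub] card_permutes_extending_le[OF assms(1,2), of f] by linarith
    then have le: "real (card {\<pi>. \<pi> \<in> ?P \<and> restrict \<pi> I = f}) \<le> fact (card S - card I)"
      by (metis of_nat_fact of_nat_le_iff)
    have "(\<Sum>\<pi>\<in>{\<pi>. \<pi> \<in> ?P \<and> restrict \<pi> I = f}. \<Prod>i\<in>I. c i (\<pi> i)) =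
        (\<Sum>\<pi>\<in>{\<pi>. \<pi> \<in> ?P \<and> restrict \<pi> I = f}. \<Prod>i\<in>I. c i (f i))"
      by (intro sum.cong prod.cong) auto
    also have "\<dots> = real (card {\<pi>. \<pi> \<in> ?P \<and> restrict \<pi> I = f}) * (\<Prod>i\<in>I. c i (f i))"
      by simp
    also have "\<dots> \<le> fact (card S - card I) * (\<Prod>i\<in>I. c i (f i))"
      using le nn by (intro mult_right_mono prod_nonneg) auto
    finally show "(\<Sum>\<pi>\<in>{\<pi>. \<pi> \<in> ?P \<and> restrict \<pi> I = f}. \<Prod>i\<in>I. c i (\<pi> i)) \<le>
      fact (card S - card I) * (\<Prod>i\<in>I. c i (f i))" .
  qed
  also have "\<dots> = fact (card S - card I) * (\<Prod>i\<in>I. \<Sum>j\<in>S. c i j)"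
    using assms finI by (simp only: prod_sum_PiE sum_distrib_left)
  finally show ?thesis .
qed

lemma power_le_exp_fact: "real k ^ k \<le> exp (real k) * fact k"
proof -
  have "real k ^ k /\<^sub>R fact k \<le> (\<Sum>n. real k ^ n /\<^sub>R fact n)"
    using summable_exp_generic[of "real k"]
    by (intro sum_le_suminf[of _ "{k}", simplified]) auto
  then show ?thesis by (simp add: exp_def field_simps)
qed

text \<open>Follows from \<open>(n choose k) \<ge> (n / k) ^ k\<close> and the preceding bound on
  \<open>k ^ k\<close>. This is the origin of the factor e in the product bound.\<close>

lemma fact_diff_le:
  assumes "k \<le> n" "0 < n"
  shows "fact (n - k) / fact n \<le> (exp 1 / real n) ^ k"
proof (cases "k = 0")
  case False
  have "(real n / real k) ^ k \<le> real (n choose k)"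
    using binomial_ge_n_over_k_pow_k[OF assms(1), where 'a=real] by simp
  also have "real (n choose k) = fact n / (fact k * fact (n - k))"
    using assms by (simp add: binomial_fact)
  finally have *: "real n ^ k * (fact k * fact (n - k)) \<le> fact n * real k ^ k"
    using False by (simp add: field_simps power_divide)
  also have "\<dots> \<le> fact n * (exp (real k) * fact k)"
    using power_le_exp_fact[of k] by (intro mult_left_mono) auto
  finally have "fact k * (real n ^ k * fact (n - k)) \<le> fact k * (fact n * exp (real k))"
    by (simp add: algebra_simps)
  then have "real n ^ k * fact (n - k) \<le> fact n * exp (real k)"
    by (rule mult_left_le_imp_le) simp
  then show ?thesis using assms
    by (simp add: field_simps power_divide flip: exp_of_nat_mult)
qed simp

text \<open>Independent uniform choices in the rows would give the same bound without the factor
  \<open>exp 1\<close> in the exponent.\<close>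

lemma mean_permutes_prod_le:
  fixes c :: "'a \<Rightarrow> 'a \<Rightarrow> real"
  assumes "finite S" "S \<noteq> {}" and nn: "\<And>i j. c i j \<ge> 0"
  shows "(\<Sum>\<pi> | \<pi> permutes S. \<Prod>i\<in>S. 1 + c i (\<pi> i)) / fact (card S)
    \<le> exp (exp 1 / card S * (\<Sum>i\<in>S. \<Sum>j\<in>S. c i j))"
proof -
  define n where "n = card S"
  have n: "n > 0" using assms by (auto simp: n_def card_gt_0_iff)
  define R where "R i = (\<Sum>j\<in>S. c i j)" for i
  have R: "R i \<ge> 0" for i using nn by (auto simp: R_def intro: sum_nonneg)
  have "(\<Sum>\<pi> | \<pi> permutes S. \<Prod>i\<in>S. 1 + c i (\<pi> i)) / fact n =
      (\<Sum>\<pi> | \<pi> permutes S. \<Sum>I\<in>Pow S. \<Prod>i\<in>I. c i (\<pi> i)) / fact n"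
    using prod_add[OF assms(1), of "\<lambda>i. c i (\<pi> i)" "\<lambda>_. 1" for \<pi>] by (simp add: add.commute)
  also have "\<dots> = (\<Sum>I\<in>Pow S. (\<Sum>\<pi> | \<pi> permutes S. \<Prod>i\<in>I. c i (\<pi> i)) / fact n)"
    by (subst sum.swap) (simp add: sum_divide_distrib)
  also have "\<dots> \<le> (\<Sum>I\<in>Pow S. \<Prod>i\<in>I. exp 1 / n * R i)"
  proof (rule sum_mono)
    fix I assume "I \<in> Pow S"
    then have I: "I \<subseteq> S" by simp
    have "(\<Sum>\<pi> | \<pi> permutes S. \<Prod>i\<in>I. c i (\<pi> i)) / fact n \<le> fact (n - card I) * prod R I / fact n"
      unfolding n_def R_def using sum_permutes_prod_le[OF assms(1) I nn]
      by (intro divide_right_mono) auto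
    also have "\<dots> = fact (n - card I) / fact n * prod R I" by simp
    also have "\<dots> \<le> (exp 1 / n) ^ card I * prod R I"
      using n R I assms(1) card_mono[of S I]
      by (intro mult_right_mono fact_diff_le prod_nonneg) (auto simp: n_def)
    also have "\<dots> = (\<Prod>i\<in>I. exp 1 / n * R i)" by (simp only: prod.distrib prod_constant)
    finally show "(\<Sum>\<pi> | \<pi> permutes S. \<Prod>i\<in>I. c i (\<pi> i)) / fact n \<le> (\<Prod>i\<in>I. exp 1 / n * R i)" .
  qed
  \<comment> \<open>The factors no longer depend on \<open>\<pi>\<close>, so the expansion over
    subsets folds back into a product.\<close>
  also have "\<dots> = (\<Prod>i\<in>S. exp 1 / n * R i + 1)"
    using prod_add[OF assms(1), of "\<lambda>i. exp 1 / n * R i" "\<lambda>_. 1"] by simp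
  also have "\<dots> \<le> (\<Prod>i\<in>S. exp (exp 1 / n * R i))"
    using R n by (intro prod_mono) (auto intro!: add_nonneg_nonneg simp: add.commute)
  also have "\<dots> = exp (exp 1 / n * (\<Sum>i\<in>S. R i))"
    using assms(1) by (simp add: exp_sum sum_distrib_left)
  finally show ?thesis by (simp add: n_def R_def)
qed

text \<open>Precomposition with a transposition shows that the sum is the same for every position
  \<open>i\<close>; summed over all positions, each permutation runs once through
  \<open>S\<close>.\<close>

lemma sum_permutes_eval:
  fixes f :: "'a \<Rightarrow> real"
  assumes "finite S" "i \<in> S"
  shows "(\<Sum>\<pi> | \<pi> permutes S. f (\<pi> i)) / fact (card S) = (\<Sum>j\<in>S. f j) / card S"
proof -
  have eq: "(\<Sum>\<pi> | \<pi> permutes S. f (\<pi> i)) = (\<Sum>\<pi> | \<pi> permutes S. f (\<pi> k))" if "k \<in> S" for k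
  proof -
    have t: "Transposition.transpose i k permutes S" using assms that by (intro permutes_swap_id)
    have "(\<Sum>\<pi> | \<pi> permutes S. f (\<pi> k)) = (\<Sum>\<pi> | \<pi> permutes S. f ((\<pi> \<circ> Transposition.transpose i k) k))"
      using sum_permutations_compose_right[OF t, of "\<lambda>\<pi>. f (\<pi> k)"] by simp
    then show ?thesis by simp
  qed
  have "real (card S) * (\<Sum>\<pi> | \<pi> permutes S. f (\<pi> i)) = (\<Sum>k\<in>S. \<Sum>\<pi> | \<pi> permutes S. f (\<pi> k))"
    by (simp add: eq[symmetric])
  also have "\<dots> = (\<Sum>\<pi> | \<pi> permutes S. \<Sum>k\<in>S. f (\<pi> k))" by (rule sum.swap)
  also have "\<dots> = (\<Sum>\<pi> | \<pi> permutes S. \<Sum>j\<in>S. f j)"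
  proof (rule sum.cong[OF refl])
    fix \<pi> assume "\<pi> \<in> {\<pi>. \<pi> permutes S}"
    then show "(\<Sum>k\<in>S. f (\<pi> k)) = sum f S" using sum.permute[of \<pi> S f] by (simp add: o_def)
  qed
  also have "\<dots> = fact (card S) * (\<Sum>j\<in>S. f j)"
    using assms by (simp add: card_permutations)
  finally have "real (card S) * (\<Sum>\<pi> | \<pi> permutes S. f (\<pi> i)) = fact (card S) * (\<Sum>j\<in>S. f j)" .
  moreover have "real (card S) > 0" using assms by (auto simp: card_gt_0_iff)
  ultimately show ?thesis by (simp add: field_simps)
qed

lemma sum_permutes_sum:
  fixes a :: "'a \<Rightarrow> 'a \<Rightarrow> real"
  assumes "finite S"
  shows "(\<Sum>\<pi> | \<pi> permutes S. \<Sum>i\<in>S. a i (\<pi> i)) / fact (card S) = (\<Sum>i\<in>S. \<Sum>j\<in>S. a i j) / card S"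
proof -
  have "(\<Sum>\<pi> | \<pi> permutes S. \<Sum>i\<in>S. a i (\<pi> i)) / fact (card S) =
      (\<Sum>i\<in>S. (\<Sum>\<pi> | \<pi> permutes S. a i (\<pi> i)) / fact (card S))"
    by (subst sum.swap) (simp add: sum_divide_distrib)
  also have "\<dots> = (\<Sum>i\<in>S. (\<Sum>j\<in>S. a i j) / card S)"
    using assms by (intro sum.cong refl sum_permutes_eval)
  finally show ?thesis by (simp add: sum_divide_distrib)
qed

text \<open>Bounds the second moment of the number of hits divided by its mean: \<open>exp 1\<close>
  is the factor of the product bound, \<open>exp 1 - 1\<close> the increment of the exponential per
  hit, and 2 comes from \<open>x\<^sup>2 \<le> 2 * (exp x - 1)\<close>.\<close>

definition hit_const :: real where
  "hit_const = 2 * (exp (exp 1 * (exp 1 - 1)) - 1)"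

lemma hit_const_ge: "hit_const \<ge> 2"
proof -
  have e: "exp (1::real) \<ge> 2" using exp_ge_add_one_self[of 1] by simp
  have "1 \<le> exp (1::real) * (exp 1 - 1)" using mult_mono[of 1 "exp (1::real)" 1 "exp 1 - 1"] e by simp
  then have "exp (exp (1::real) * (exp 1 - 1)) \<ge> 2" using e exp_le_cancel_iff order_trans by blast
  then show ?thesis by (simp add: hit_const_def)
qed

lemma exp_le_chord:
  fixes t K :: real
  assumes "0 \<le> t" "t \<le> 1"
  shows "exp (t * K) - 1 \<le> t * (exp K - 1)"
  using convex_onD[OF exp_convex, of t 0 K] assms by (simp add: algebra_simps)

lemma exp_ge_quadratic:
  fixes x :: real
  assumes "0 \<le> x"
  shows "x\<^sup>2 \<le> 2 * (exp x - 1)"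
  using exp_lower_Taylor_quadratic[OF assms] assms by (simp add: algebra_simps)

text \<open>Second moment method: if \<open>X\<close> is the number of hits, then \<open>2tX - t\<^sup>2X\<^sup>2\<close> is at most \<open>1\<close>, and
  \<open>0\<close> without a hit. The second moment of \<open>X\<close> is bounded through \<open>X\<^sup>2 \<le> 2(e\<^sup>X - 1)\<close> and
  \<open>mean_permutes_prod_le\<close>, which gives the value of \<open>hit_const\<close>.\<close>

lemma permutes_hit_probability:
  assumes "finite S" "B \<subseteq> S \<times> S" "card B \<le> card S"
  shows "card B / card S \<le>
    hit_const * (card {\<pi>. \<pi> permutes S \<and> (\<exists>i\<in>S. (i, \<pi> i) \<in> B)} / fact (card S))"
proof (cases "S = {}")
  case False
  define n where "n = card S"
  have n: "n > 0" using assms False by (auto simp: n_def card_gt_0_iff)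
  define b where "b i j = (indicator B (i, j) :: real)" for i j
  define X where "X \<pi> = (\<Sum>i\<in>S. b i (\<pi> i))" for \<pi>
  define \<beta> where "\<beta> = card B / n"
  have \<beta>: "0 \<le> \<beta>" "\<beta> \<le> 1" using assms n by (auto simp: \<beta>_def n_def)
  have X0: "X \<pi> \<ge> 0" for \<pi> by (auto simp: X_def b_def intro: sum_nonneg)
  have sumb: "(\<Sum>i\<in>S. \<Sum>j\<in>S. b i j) = card B"
  proof -
    have "(\<Sum>i\<in>S. \<Sum>j\<in>S. b i j) = (\<Sum>z\<in>S \<times> S. indicator B z)"
      by (simp add: b_def sum.cartesian_product)
    also have "\<dots> = card B" using assms finite_subset[OF assms(2)]
      by (subst sum.mono_neutral_right[where S=B]) (auto simp: indicator_def)
    finally show ?thesis .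
  qed
  have EX: "(\<Sum>\<pi> | \<pi> permutes S. X \<pi>) / fact n = \<beta>"
    unfolding X_def n_def \<beta>_def using sum_permutes_sum[OF assms(1), of b] sumb by simp
  let ?C = "hit_const"
  have "(\<Sum>\<pi> | \<pi> permutes S. (X \<pi>)\<^sup>2) / fact n \<le> (\<Sum>\<pi> | \<pi> permutes S. 2 * (exp (X \<pi>) - 1)) / fact n"
    by (intro divide_right_mono sum_mono exp_ge_quadratic X0) auto
  also have "\<dots> = 2 * ((\<Sum>\<pi> | \<pi> permutes S. exp (X \<pi>)) / fact n - 1)"
    using assms by (simp add: sum_subtractf flip: sum_distrib_left) (simp add: n_def card_permutations field_simps)
  \<comment> \<open>\<open>b\<close> takes only the values 0 and 1, where its exponential agrees
    with \<open>1 + (exp 1 - 1) * b\<close>.\<close>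
  also have "(\<Sum>\<pi> | \<pi> permutes S. exp (X \<pi>)) = (\<Sum>\<pi> | \<pi> permutes S. \<Prod>i\<in>S. 1 + (exp 1 - 1) * b i (\<pi> i))"
  proof (rule sum.cong[OF refl])
    fix \<pi>
    have "exp (X \<pi>) = (\<Prod>i\<in>S. exp (b i (\<pi> i)))" unfolding X_def using assms(1) by (rule exp_sum)
    also have "\<dots> = (\<Prod>i\<in>S. 1 + (exp 1 - 1) * b i (\<pi> i))"
      by (rule prod.cong) (simp_all add: b_def indicator_def)
    finally show "exp (X \<pi>) = (\<Prod>i\<in>S. 1 + (exp 1 - 1) * b i (\<pi> i))" .
  qed
  also have "2 * ((\<Sum>\<pi> | \<pi> permutes S. \<Prod>i\<in>S. 1 + (exp 1 - 1) * b i (\<pi> i)) / fact n - 1)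
      \<le> 2 * (exp (exp 1 / n * (\<Sum>i\<in>S. \<Sum>j\<in>S. (exp 1 - 1) * b i j)) - 1)"
    unfolding n_def using assms False
    by (intro mult_left_mono diff_right_mono mean_permutes_prod_le) (auto simp: b_def)
  also have "exp 1 / n * (\<Sum>i\<in>S. \<Sum>j\<in>S. (exp 1 - 1) * b i j) = \<beta> * (exp 1 * (exp 1 - 1))"
    by (simp add: sumb \<beta>_def flip: sum_distrib_left)
  also have "2 * (exp (\<beta> * (exp 1 * (exp 1 - 1))) - 1) \<le> \<beta> * ?C"
    using exp_le_chord[OF \<beta>, of "exp 1 * (exp 1 - 1)"]
    by (simp only: hit_const_def mult.left_commute[of \<beta> 2] mult_le_cancel_left_pos[OF zero_less_numeral])
  finally have EX2: "(\<Sum>\<pi> | \<pi> permutes S. (X \<pi>)\<^sup>2) / fact n \<le> \<beta> * ?C" .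
  \<comment> \<open>This choice maximises the lower bound
    \<open>2 * t * \<beta> - t\<^sup>2 * (\<beta> * ?C)\<close>, whose value becomes
    \<open>\<beta> / ?C\<close>.\<close>
  define t where "t = 1 / ?C"
  have C: "?C > 0" using hit_const_ge by simp
  have "2 * t * \<beta> - t\<^sup>2 * (\<beta> * ?C) \<le>
      2 * t * ((\<Sum>\<pi> | \<pi> permutes S. X \<pi>) / fact n) - t\<^sup>2 * ((\<Sum>\<pi> | \<pi> permutes S. (X \<pi>)\<^sup>2) / fact n)"
    unfolding EX by (intro diff_left_mono mult_left_mono EX2) auto
  also have "\<dots> = (\<Sum>\<pi> | \<pi> permutes S. 2 * t * X \<pi> - t\<^sup>2 * (X \<pi>)\<^sup>2) / fact n"
    by (simp add: sum_subtractf diff_divide_distrib flip: sum_distrib_left)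
  also have "\<dots> \<le> (\<Sum>\<pi> | \<pi> permutes S. of_bool (\<exists>i\<in>S. (i, \<pi> i) \<in> B)) / fact n"
  proof (intro divide_right_mono sum_mono)
    fix \<pi>
    have "0 \<le> (1 - t * X \<pi>)\<^sup>2" by simp
    then have "2 * t * X \<pi> - t\<^sup>2 * (X \<pi>)\<^sup>2 \<le> 1" by (simp add: power2_eq_square algebra_simps)
    moreover have "X \<pi> = 0" if "\<not> (\<exists>i\<in>S. (i, \<pi> i) \<in> B)"
      using that by (auto simp: X_def b_def)
    ultimately show "2 * t * X \<pi> - t\<^sup>2 * (X \<pi>)\<^sup>2 \<le> of_bool (\<exists>i\<in>S. (i, \<pi> i) \<in> B)" by auto
  qed simp
  also have "\<dots> = card {\<pi>. \<pi> permutes S \<and> (\<exists>i\<in>S. (i, \<pi> i) \<in> B)} / fact n"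
    using assms by (simp add: of_bool_def sum.If_cases finite_permutations Collect_conj_eq)
  also have "2 * t * \<beta> - t\<^sup>2 * (\<beta> * ?C) = \<beta> / ?C"
    using C by (simp add: t_def power2_eq_square field_simps)
  finally have "\<beta> / ?C * ?C \<le> card {\<pi>. \<pi> permutes S \<and> (\<exists>i\<in>S. (i, \<pi> i) \<in> B)} / fact n * ?C"
    using C by (intro mult_right_mono) auto
  then show ?thesis using C by (simp add: \<beta>_def n_def mult.commute)
qed simp

subsection \<open>Subadditivity of concave powers\<close>

text \<open>By homogeneity the sum may be normalised to 1, and a number in the unit interval is at
  most its \<open>s\<close>-th power.\<close>

lemma add_powr_le:
  fixes x y s :: real
  assumes "0 \<le> x" "0 \<le> y" "0 < s" "s \<le> 1"
  shows "(x + y) powr s \<le> x powr s + y powr s"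
proof (cases "x + y = 0")
  case False
  define w where "w = x + y"
  have w: "w > 0" using False assms by (auto simp: w_def)
  have *: "z / w \<le> (z / w) powr s" if "0 \<le> z" "z \<le> w" for z
    using powr_mono'[of s 1 "z / w"] that w assms by simp
  have "1 = x / w + y / w" using w by (simp add: w_def flip: add_divide_distrib)
  also have "\<dots> \<le> (x / w) powr s + (y / w) powr s"
    using assms by (intro add_mono *) (auto simp: w_def)
  also have "\<dots> = (x powr s + y powr s) / w powr s"
    using assms w by (simp add: powr_divide add_divide_distrib)
  finally show ?thesis using w by (simp add: field_simps w_def)
qed (use assms in auto)

text \<open>The leading 1 keeps every partial sum \<open>W\<close> at least 1. Adding
  \<open>z\<close> then raises the power by at most \<open>z powr s\<close>, by subadditivity, and
  also by at most \<open>z\<close>, since the slope of the power beyond 1 is at most 1.\<close>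

lemma one_plus_sum_powr_le:
  fixes z :: "'a \<Rightarrow> real"
  assumes "finite A" and z: "\<And>i. i \<in> A \<Longrightarrow> 0 \<le> z i" and s: "0 < s" "s \<le> 1"
  shows "(1 + (\<Sum>i\<in>A. z i)) powr s \<le> 1 + (\<Sum>i\<in>A. min (z i) (z i powr s))"
  using assms(1,2)
proof (induction A rule: finite_induct)
  case (insert i A)
  define W where "W = 1 + (\<Sum>i\<in>A. z i)"
  have W: "W \<ge> 1" using insert by (auto simp: W_def intro: sum_nonneg)
  have zi: "z i \<ge> 0" using insert by simp
  have "(W + z i) powr s \<le> W powr s + z i powr s" using W zi s by (intro add_powr_le) auto
  moreover have "(W + z i) powr s \<le> W powr s + z i"
  proof -
    have "(W + z i) powr s = W powr s * (1 + z i / W) powr s"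
    proof -
      have "W + z i = W * (1 + z i / W)" using W by (simp add: field_simps)
      then show ?thesis using W zi by (metis powr_mult)
    qed
    also have "\<dots> \<le> W powr s * (1 + z i / W)"
      using W zi s powr_mono[of s 1 "1 + z i / W"] by (intro mult_left_mono) auto
    also have "\<dots> = W powr s + (W powr s / W) * z i" by (simp add: algebra_simps)
    also have "\<dots> \<le> W powr s + 1 * z i"
      using W zi s powr_mono[of s 1 W] by (intro add_left_mono mult_right_mono) auto
    finally show ?thesis by simp
  qed
  moreover have "W powr s \<le> 1 + (\<Sum>i\<in>A. min (z i) (z i powr s))"
    unfolding W_def using insert by auto
  ultimately show ?case using insert by (simp add: W_def algebra_simps)
qed simp

subsection \<open>Decreasing rearrangement of a matrix\<close>

definition abs_entries :: "nat \<Rightarrow> (nat \<Rightarrow> nat \<Rightarrow> real) \<Rightarrow> real list" where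
  "abs_entries n x = [\<bar>x i j\<bar>. i \<leftarrow> [1..<n+1], j \<leftarrow> [1..<n+1]]"

lemma length_abs_entries [simp]: "length (abs_entries n x) = n\<^sup>2"
  by (simp add: abs_entries_def length_concat comp_def sum_list_triv power2_eq_square)

lemma decr_rearr_eq: "decr_rearr n x k = rev (sort (abs_entries n x)) ! (k - 1)"
  by (simp only: decr_rearr_def abs_entries_def)

lemma sum_list_concat_map: "sum_list (concat (map g xs)) = (\<Sum>x\<leftarrow>xs. sum_list (g x))"
  by (induction xs) auto

text \<open>Sorting preserves the multiset of entries. This turns the double sums produced by
  averaging over permutations into sums over the rearrangement.\<close>

lemma sum_decr_rearr:
  "(\<Sum>k=1..n\<^sup>2. f (decr_rearr n x k)) = (\<Sum>i=1..n. \<Sum>j=1..n. f \<bar>x i j\<bar> :: real)"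
proof -
  have "(\<Sum>k=1..n\<^sup>2. f (decr_rearr n x k)) = (\<Sum>k<n\<^sup>2. f (rev (sort (abs_entries n x)) ! k))"
    by (rule sum.reindex_bij_witness[of _ Suc "\<lambda>k. k - 1"]) (auto simp: decr_rearr_eq)
  also have "\<dots> = sum_list (map f (rev (sort (abs_entries n x))))"
    by (simp add: sum_list_sum_nth atLeast0LessThan)
  also have "\<dots> = sum_mset (mset (map f (rev (sort (abs_entries n x)))))" by (rule sum_mset_sum_list[symmetric])
  also have "\<dots> = sum_mset (mset (map f (abs_entries n x)))" by (simp only: mset_map mset_rev mset_sort)
  also have "\<dots> = sum_list (map f (abs_entries n x))" by (rule sum_mset_sum_list)
  also have "\<dots> = (\<Sum>i=1..n. \<Sum>j=1..n. f \<bar>x i j\<bar>)"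
    by (simp add: abs_entries_def map_concat comp_def sum_list_concat_map interv_sum_list_conv_sum_set_nat
      atLeastLessThanSuc_atLeastAtMost del: upt_Suc)
  finally show ?thesis .
qed

lemma decr_rearr_antimono:
  assumes "1 \<le> k" "k \<le> k'" "k' \<le> n\<^sup>2"
  shows "decr_rearr n x k' \<le> decr_rearr n x k"
proof -
  show ?thesis using assms sorted_rev_nth_mono[of "rev (sort (abs_entries n x))" "k - 1" "k' - 1"]
    by (simp add: decr_rearr_eq)
qed

lemma decr_rearr_in:
  assumes "1 \<le> k" "k \<le> n\<^sup>2"
  shows "\<exists>i\<in>{1..n}. \<exists>j\<in>{1..n}. decr_rearr n x k = \<bar>x i j\<bar>"
proof -
  have "rev (sort (abs_entries n x)) ! (k - 1) \<in> set (rev (sort (abs_entries n x)))" using assms by (intro nth_mem) auto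
  then have "decr_rearr n x k \<in> set (abs_entries n x)" by (simp add: decr_rearr_eq)
  then show ?thesis by (force simp: abs_entries_def simp del: upt_Suc)
qed

lemma decr_rearr_nonneg: "\<lbrakk>1 \<le> k; k \<le> n\<^sup>2\<rbrakk> \<Longrightarrow> 0 \<le> decr_rearr n x k"
  using decr_rearr_in[of k n x] by auto

text \<open>The indicator of the threshold is summed over the rearrangement, whose first
  \<open>k\<close> members pass it, and then over the entries. Ties at the threshold can make the
  inequality strict.\<close>

lemma card_ge_decr_rearr:
  assumes "1 \<le> k" "k \<le> n\<^sup>2"
  shows "k \<le> card {(i, j) \<in> {1..n} \<times> {1..n}. decr_rearr n x k \<le> \<bar>x i j\<bar>}"
proof -
  let ?f = "\<lambda>u. of_bool (decr_rearr n x k \<le> u) :: real"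
  have "real k = (\<Sum>k'=1..k. ?f (decr_rearr n x k'))"
    using assms decr_rearr_antimono[of _ k n x] by simp
  also have "\<dots> \<le> (\<Sum>k'=1..n\<^sup>2. ?f (decr_rearr n x k'))"
    using assms by (intro sum_mono2) auto
  also have "\<dots> = (\<Sum>i=1..n. \<Sum>j=1..n. ?f \<bar>x i j\<bar>)" by (rule sum_decr_rearr)
  also have "\<dots> = card {(i, j) \<in> {1..n} \<times> {1..n}. decr_rearr n x k \<le> \<bar>x i j\<bar>}"
  proof -
    let ?B = "{(i, j) \<in> {1..n} \<times> {1..n}. decr_rearr n x k \<le> \<bar>x i j\<bar>}"
    have "(\<Sum>i=1..n. \<Sum>j=1..n. ?f \<bar>x i j\<bar>) = (\<Sum>(i, j)\<in>{1..n} \<times> {1..n}. ?f \<bar>x i j\<bar>)"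
      by (rule sum.cartesian_product)
    also have "\<dots> = (\<Sum>z\<in>?B. 1)" by (rule sum.mono_neutral_cong_right) auto
    finally show ?thesis by simp
  qed
  finally show ?thesis by simp
qed

subsection \<open>Orlicz spaces on the unit interval\<close>

text \<open>\<open>nontrivial\<close> excludes the zero function, which
  \<open>convex_orlicz_function\<close> admits and for which \<open>fnorm\<close> would vanish
  identically.\<close>

locale orlicz =
  fixes M :: "real \<Rightarrow> real"
  assumes convex_orlicz: "convex_orlicz_function M"
    and nontrivial: "\<exists>u>0. M u > 0"
begin

lemma M_0 [simp]: "M 0 = 0"
  and M_mono: "0 \<le> u \<Longrightarrow> u \<le> v \<Longrightarrow> M u \<le> M v"
  and M_convex: "convex_on {0..} M"
  using convex_orlicz by (auto simp: convex_orlicz_function_def mono_on_def)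

lemma M_nonneg: "0 \<le> u \<Longrightarrow> 0 \<le> M u"
  using M_mono[of 0 u] by simp

lemma M_scale: "\<lbrakk>0 \<le> c; c \<le> 1; 0 \<le> u\<rbrakk> \<Longrightarrow> M (c * u) \<le> c * M u"
  using convex_onD[OF M_convex, of c 0 u] by simp

lemma M_scale_ge:
  assumes "1 \<le> c" "0 \<le> u"
  shows "c * M u \<le> M (c * u)"
  using M_scale[of "1 / c" "c * u"] assms by (simp add: field_simps)

text \<open>The even extension makes 0 an interior point of the domain, so convexity yields
  continuity everywhere, and with it measurability and the limits taken under Fatou's lemma.\<close>

lemma M_abs_convex: "convex_on UNIV (\<lambda>u. M \<bar>u\<bar>)"
proof (rule convex_onI)
  fix t x y :: real assume t: "0 < t" "t < 1"
  have "\<bar>(1 - t) *\<^sub>R x + t *\<^sub>R y\<bar> \<le> (1 - t) * \<bar>x\<bar> + t * \<bar>y\<bar>"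
    using abs_triangle_ineq[of "(1 - t) * x" "t * y"] t by (simp add: abs_mult)
  then have "M \<bar>(1 - t) *\<^sub>R x + t *\<^sub>R y\<bar> \<le> M ((1 - t) * \<bar>x\<bar> + t * \<bar>y\<bar>)"
    by (intro M_mono) auto
  also have "\<dots> \<le> (1 - t) * M \<bar>x\<bar> + t * M \<bar>y\<bar>"
    using convex_onD[OF M_convex, of t "\<bar>x\<bar>" "\<bar>y\<bar>"] t by simp
  finally show "M \<bar>(1 - t) *\<^sub>R x + t *\<^sub>R y\<bar> \<le> (1 - t) * M \<bar>x\<bar> + t * M \<bar>y\<bar>" .
qed simp

lemma M_abs_continuous: "continuous_on UNIV (\<lambda>u. M \<bar>u\<bar>)"
  by (rule convex_on_continuous[OF open_UNIV M_abs_convex])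

lemma M_abs_measurable [measurable]: "(\<lambda>u. M \<bar>u\<bar>) \<in> borel_measurable borel"
  by (rule borel_measurable_continuous_onI[OF M_abs_continuous])

lemma M_measurable_comp [measurable (raw)]:
  assumes "x \<in> borel_measurable N"
  shows "(\<lambda>t. M \<bar>x t\<bar>) \<in> borel_measurable N"
  using measurable_compose[OF assms M_abs_measurable] .

text \<open>Convexity and \<open>M 0 = 0\<close> give \<open>M u \<ge> u / v * M v\<close> beyond a
  point \<open>v\<close> with \<open>M v > 0\<close>.\<close>

lemma linear_le_M: obtains K where "K > 0" "\<And>u. 0 \<le> u \<Longrightarrow> u \<le> K * (1 + M u)"
proof -
  obtain v where v: "v > 0" "M v > 0" using nontrivial by blast
  show thesis
  proof
    show "v * (1 + 1 / M v) > 0" using v by (intro mult_pos_pos add_pos_pos) auto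
    fix u :: real assume u: "0 \<le> u"
    show "u \<le> v * (1 + 1 / M v) * (1 + M u)"
    proof (cases "u \<le> v")
      case True
      have "u \<le> v * 1 * 1" using True by simp
      also have "\<dots> \<le> v * (1 + 1 / M v) * (1 + M u)"
        using v u M_nonneg[of u] by (intro mult_mono) auto
      finally show ?thesis .
    next
      case False
      have "u / v * M v \<le> M u" using M_scale_ge[of "u / v" v] False v u by simp
      then have "u \<le> v * (1 / M v) * M u" using v by (simp add: field_simps)
      also have "\<dots> \<le> v * (1 + 1 / M v) * (1 + M u)"
        using v u M_nonneg[of u] by (intro mult_mono) auto
      finally show ?thesis .
    qed
  qed
qed

section \<open>Modular and Luxemburg norm\<close>

abbreviation "E \<equiv> orlicz_space M"
abbreviation "modular \<equiv> orlicz_modular M"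

lemma elems_iff: "x \<in> elems E \<longleftrightarrow> x \<in> borel_measurable unit_leb \<and> (\<exists>r>0. modular (\<lambda>t. x t / r) \<le> 1)"
  by (simp add: orlicz_space_def)

lemma elems_measurable: "x \<in> elems E \<Longrightarrow> x \<in> borel_measurable unit_leb"
  by (simp add: elems_iff)

lemma norm_eq: "fnorm E x = Inf {r. r > 0 \<and> modular (\<lambda>t. x t / r) \<le> 1}"
  by (simp add: orlicz_space_def)

lemma bdd_below_norm: "bdd_below {r::real. r > 0 \<and> P r}"
  by (rule bdd_belowI[of _ 0]) auto

lemma norm_le: "0 < r \<Longrightarrow> modular (\<lambda>t. x t / r) \<le> 1 \<Longrightarrow> fnorm E x \<le> r"
  unfolding norm_eq by (intro cInf_lower bdd_below_norm) auto

lemma modular_mono_AE: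
  "AE t in unit_leb. \<bar>x t\<bar> \<le> \<bar>y t\<bar> \<Longrightarrow> modular x \<le> modular y"
  unfolding orlicz_modular_def
  by (intro nn_integral_mono_AE) (auto elim!: eventually_mono intro!: ennreal_leI M_mono)

lemma modular_mono: "(\<And>t. \<bar>x t\<bar> \<le> \<bar>y t\<bar>) \<Longrightarrow> modular x \<le> modular y"
  by (intro modular_mono_AE) auto

text \<open>With \<open>r\<close> strictly above the norm, attainment of the infimum is never an
  issue; later estimates are proved for all such \<open>r\<close>, and \<open>dense_ge\<close>
  passes to the norm.\<close>

lemma modular_le_of_norm_less:
  assumes "x \<in> elems E" "fnorm E x < r"
  shows "0 < r" "modular (\<lambda>t. x t / r) \<le> 1"
proof -
  obtain s where s: "s > 0" "modular (\<lambda>t. x t / s) \<le> 1" "s < r"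
    using assms cInf_lessD[of "{r. r > 0 \<and> modular (\<lambda>t. x t / r) \<le> 1}" r]
    by (auto simp: norm_eq elems_iff)
  then show "0 < r" by simp
  have "modular (\<lambda>t. x t / r) \<le> modular (\<lambda>t. x t / s)"
    using s by (intro modular_mono) (auto intro: divide_left_mono)
  then show "modular (\<lambda>t. x t / r) \<le> 1" using s(2) by (rule order_trans)
qed

lemma norm_nonneg: "x \<in> elems E \<Longrightarrow> 0 \<le> fnorm E x"
  unfolding norm_eq elems_iff by (intro cInf_greatest) auto

lemma modular_scale:
  assumes "x \<in> borel_measurable unit_leb" "0 \<le> c" "c \<le> 1"
  shows "modular (\<lambda>t. c * x t) \<le> ennreal c * modular x"
proof -
  have [measurable]: "x \<in> borel_measurable unit_leb" by fact
  have "modular (\<lambda>t. c * x t) \<le> (\<integral>\<^sup>+t. ennreal c * ennreal (M \<bar>x t\<bar>) \<partial>unit_leb)"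
    unfolding orlicz_modular_def using assms M_scale
    by (intro nn_integral_mono) (auto simp: abs_mult M_nonneg simp flip: ennreal_mult intro!: ennreal_leI)
  also have "\<dots> = ennreal c * modular x"
    unfolding orlicz_modular_def by (intro nn_integral_cmult) measurable
  finally show ?thesis .
qed

text \<open>Convexity and \<open>M 0 = 0\<close> give \<open>M (u / K) \<le> M u / K\<close>, so a
  modular bounded by a constant other than 1 costs only that factor in the norm.\<close>

lemma elems_norm_le:
  assumes "x \<in> borel_measurable unit_leb" "0 < r" "1 \<le> K" "modular (\<lambda>t. x t / r) \<le> ennreal K"
  shows "x \<in> elems E" "fnorm E x \<le> K * r"
proof -
  have "modular (\<lambda>t. x t / (K * r)) = modular (\<lambda>t. (1 / K) * (x t / r))" by simp
  also have "\<dots> \<le> ennreal (1 / K) * modular (\<lambda>t. x t / r)"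
    using assms by (intro modular_scale) auto
  also have "\<dots> \<le> ennreal (1 / K) * ennreal K" using assms by (intro mult_left_mono) auto
  also have "\<dots> = 1" using assms by (simp flip: ennreal_mult)
  finally have *: "modular (\<lambda>t. x t / (K * r)) \<le> 1" .
  then show "fnorm E x \<le> K * r" using assms by (intro norm_le) auto
  show "x \<in> elems E" using * assms by (auto simp: elems_iff intro!: exI[of _ "K * r"])
qed

text \<open>The quotient is the convex combination of \<open>x t / r\<close> and
  \<open>y t / s\<close> with weights \<open>r / (r + s)\<close> and \<open>s / (r + s)\<close>, the
  usual argument for a Minkowski functional.\<close>

lemma modular_add_le:
  assumes "x \<in> borel_measurable unit_leb" "y \<in> borel_measurable unit_leb"
    and "0 < r" "0 < s" "modular (\<lambda>t. x t / r) \<le> 1" "modular (\<lambda>t. y t / s) \<le> 1"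
  shows "modular (\<lambda>t. (x t + y t) / (r + s)) \<le> 1"
proof -
  have [measurable]: "x \<in> borel_measurable unit_leb" "y \<in> borel_measurable unit_leb" by fact+
  define a where "a = s / (r + s)"
  have a: "0 < a" "a < 1" "1 - a = r / (r + s)" using assms by (auto simp: a_def field_simps)
  have "M \<bar>(x t + y t) / (r + s)\<bar> \<le> (1 - a) * M \<bar>x t / r\<bar> + a * M \<bar>y t / s\<bar>" for t
  proof -
    have "(x t + y t) / (r + s) = (1 - a) * (x t / r) + a * (y t / s)"
      using assms unfolding a(3) by (simp add: a_def add_divide_distrib)
    then show ?thesis
      using convex_onD[OF M_abs_convex, of a "x t / r" "y t / s"] a by simp
  qed
  then have "modular (\<lambda>t. (x t + y t) / (r + s)) \<le>
      (\<integral>\<^sup>+t. ennreal (1 - a) * ennreal (M \<bar>x t / r\<bar>) + ennreal a * ennreal (M \<bar>y t / s\<bar>) \<partial>unit_leb)"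
    unfolding orlicz_modular_def
  proof (intro nn_integral_mono)
    fix t
    have "ennreal (M \<bar>(x t + y t) / (r + s)\<bar>) \<le> ennreal ((1 - a) * M \<bar>x t / r\<bar> + a * M \<bar>y t / s\<bar>)"
      by (intro ennreal_leI) fact
    also have "\<dots> = ennreal (1 - a) * ennreal (M \<bar>x t / r\<bar>) + ennreal a * ennreal (M \<bar>y t / s\<bar>)"
      using a(1,2) by (simp only: ennreal_plus ennreal_mult M_nonneg abs_ge_zero mult_nonneg_nonneg less_imp_le diff_ge_0_iff_ge)
    finally show "ennreal (M \<bar>(x t + y t) / (r + s)\<bar>) \<le>
      ennreal (1 - a) * ennreal (M \<bar>x t / r\<bar>) + ennreal a * ennreal (M \<bar>y t / s\<bar>)" .
  qed
  also have "\<dots> = ennreal (1 - a) * modular (\<lambda>t. x t / r) + ennreal a * modular (\<lambda>t. y t / s)"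
    unfolding orlicz_modular_def
    by (subst nn_integral_add) (auto simp: nn_integral_cmult simp del: abs_divide)
  also have "\<dots> \<le> ennreal (1 - a) * 1 + ennreal a * 1"
    using assms by (intro add_mono mult_left_mono) auto
  also have "\<dots> = 1" using a by (simp flip: ennreal_plus)
  finally show ?thesis .
qed

lemma elems_add:
  assumes "x \<in> elems E" "y \<in> elems E"
  shows "(\<lambda>t. x t + y t) \<in> elems E" "fnorm E (\<lambda>t. x t + y t) \<le> fnorm E x + fnorm E y"
proof -
  have [measurable]: "x \<in> borel_measurable unit_leb" "y \<in> borel_measurable unit_leb"
    using assms by (auto simp: elems_iff)
  have *: "r > 0 \<and> s > 0 \<and> modular (\<lambda>t. (x t + y t) / (r + s)) \<le> 1"
    if "fnorm E x < r" "fnorm E y < s" for r s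
    using modular_le_of_norm_less[OF assms(1) that(1)] modular_le_of_norm_less[OF assms(2) that(2)]
    by (auto intro: modular_add_le)
  from *[of "fnorm E x + 1" "fnorm E y + 1"] show "(\<lambda>t. x t + y t) \<in> elems E"
    by (auto simp: elems_iff intro!: exI[of _ "fnorm E x + 1 + (fnorm E y + 1)"])
  show "fnorm E (\<lambda>t. x t + y t) \<le> fnorm E x + fnorm E y"
  proof (rule field_le_epsilon)
    fix e :: real assume "e > 0"
    then have "fnorm E (\<lambda>t. x t + y t) \<le> (fnorm E x + e / 2) + (fnorm E y + e / 2)"
      using *[of "fnorm E x + e / 2" "fnorm E y + e / 2"] by (intro norm_le) auto
    then show "fnorm E (\<lambda>t. x t + y t) \<le> fnorm E x + fnorm E y + e" by simp
  qed
qed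

lemma modular_0: "modular (\<lambda>t. 0) = 0"
  by (simp add: orlicz_modular_def)

lemma elems_AE_0:
  assumes "x \<in> borel_measurable unit_leb" "AE t in unit_leb. x t = 0"
  shows "x \<in> elems E" "fnorm E x = 0"
proof -
  have *: "modular (\<lambda>t. x t / r) \<le> 1" for r
  proof -
    have "modular (\<lambda>t. x t / r) \<le> modular (\<lambda>t. 0)"
      using assms(2) by (intro modular_mono_AE) (auto elim: AE_mp)
    then show ?thesis by (simp add: modular_0)
  qed
  from *[of 1] show x: "x \<in> elems E" using assms by (auto simp: elems_iff intro: exI[of _ 1])
  have "fnorm E x \<le> 0"
  proof (rule field_le_epsilon)
    fix e :: real assume "e > 0"
    then show "fnorm E x \<le> 0 + e" using * by (simp add: norm_le)
  qed
  then show "fnorm E x = 0" using norm_nonneg[OF x] by simp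
qed

lemma elems_cmult_le:
  assumes "x \<in> elems E"
  shows "(\<lambda>t. a * x t) \<in> elems E" "fnorm E (\<lambda>t. a * x t) \<le> \<bar>a\<bar> * fnorm E x"
proof -
  have [measurable]: "x \<in> borel_measurable unit_leb" using assms by (auto simp: elems_iff)
  have "(\<lambda>t. a * x t) \<in> elems E \<and> fnorm E (\<lambda>t. a * x t) \<le> \<bar>a\<bar> * fnorm E x"
  proof (cases "a = 0")
    case True
    then show ?thesis using elems_AE_0[of "\<lambda>_. 0"] by simp
  next
    case False
    have *: "fnorm E (\<lambda>t. a * x t) \<le> \<bar>a\<bar> * r \<and> (\<lambda>t. a * x t) \<in> elems E" if "fnorm E x < r" for r
    proof -
      have "modular (\<lambda>t. a * x t / (\<bar>a\<bar> * r)) \<le> modular (\<lambda>t. x t / r)"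
        using False by (intro modular_mono) (auto simp: abs_mult)
      then have "modular (\<lambda>t. a * x t / (\<bar>a\<bar> * r)) \<le> ennreal 1"
        using modular_le_of_norm_less(2)[OF assms that] by simp
      then show ?thesis
        using elems_norm_le[of "\<lambda>t. a * x t" "\<bar>a\<bar> * r" 1] False modular_le_of_norm_less(1)[OF assms that]
        by simp
    qed
    have "fnorm E (\<lambda>t. a * x t) / \<bar>a\<bar> \<le> fnorm E x"
    proof (rule dense_ge)
      fix r assume "fnorm E x < r"
      then show "fnorm E (\<lambda>t. a * x t) / \<bar>a\<bar> \<le> r"
        using * False by (simp add: pos_divide_le_eq mult.commute)
    qed
    then show ?thesis using False *[of "fnorm E x + 1"] by (simp add: pos_divide_le_eq mult.commute)
  qed
  then show "(\<lambda>t. a * x t) \<in> elems E" "fnorm E (\<lambda>t. a * x t) \<le> \<bar>a\<bar> * fnorm E x" by auto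
qed

lemma norm_cmult:
  assumes "x \<in> elems E"
  shows "fnorm E (\<lambda>t. a * x t) = \<bar>a\<bar> * fnorm E x"
proof (cases "a = 0")
  case True
  then show ?thesis using elems_AE_0[of "\<lambda>_. 0"] by simp
next
  case False
  have "fnorm E (\<lambda>t. (1 / a) * (a * x t)) \<le> \<bar>1 / a\<bar> * fnorm E (\<lambda>t. a * x t)"
    using assms by (intro elems_cmult_le)
  then have "\<bar>a\<bar> * fnorm E x \<le> fnorm E (\<lambda>t. a * x t)"
    using False by (simp add: field_simps)
  then show ?thesis using elems_cmult_le(2)[OF assms, of a] by simp
qed

lemma elems_diff:
  assumes "x \<in> elems E" "y \<in> elems E"
  shows "(\<lambda>t. x t - y t) \<in> elems E"
  using elems_add(1)[OF assms(1) elems_cmult_le(1)[OF assms(2), of "- 1"]] by simp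

section \<open>Embedding into the integrable functions, definiteness and completeness\<close>

lemma emeasure_unit_leb: "emeasure unit_leb {0..1} = 1"
  by (simp add: emeasure_restrict_space)

text \<open>The linear bound \<open>u \<le> K * (1 + M u)\<close> is integrated at
  \<open>u = \<bar>x t / r\<bar>\<close>; the interval and the modular contribute at most 1
  each.\<close>

lemma L1_le_norm:
  obtains K where "K > 0" "\<And>x r. x \<in> elems E \<Longrightarrow> fnorm E x < r \<Longrightarrow> (\<integral>\<^sup>+t. ennreal \<bar>x t\<bar> \<partial>unit_leb) \<le> ennreal (K * r)"
proof -
  obtain K where K: "K > 0" "\<And>u. 0 \<le> u \<Longrightarrow> u \<le> K * (1 + M u)" using linear_le_M by blast
  show thesis
  proof
    show "2 * K > 0" using K by simp
    fix x r assume x: "x \<in> elems E" "fnorm E x < r"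
    have [measurable]: "x \<in> borel_measurable unit_leb" using x by (auto simp: elems_iff)
    note r = modular_le_of_norm_less[OF x]
    have "\<bar>x t\<bar> \<le> K * r * (1 + M \<bar>x t / r\<bar>)" for t
      using K(2)[of "\<bar>x t / r\<bar>"] r(1) by (simp add: field_simps)
    then have "(\<integral>\<^sup>+t. ennreal \<bar>x t\<bar> \<partial>unit_leb) \<le>
        (\<integral>\<^sup>+t. ennreal (K * r) * (1 + ennreal (M \<bar>x t / r\<bar>)) \<partial>unit_leb)"
    proof (intro nn_integral_mono)
      fix t
      have "ennreal \<bar>x t\<bar> \<le> ennreal (K * r * (1 + M \<bar>x t / r\<bar>))" by (intro ennreal_leI) fact
      also have "\<dots> = ennreal (K * r) * (1 + ennreal (M \<bar>x t / r\<bar>))"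
        using r(1) K(1) M_nonneg[of "\<bar>x t / r\<bar>"] by (subst ennreal_mult) auto
      finally show "ennreal \<bar>x t\<bar> \<le> ennreal (K * r) * (1 + ennreal (M \<bar>x t / r\<bar>))" .
    qed
    also have "\<dots> = ennreal (K * r) * (\<integral>\<^sup>+t. 1 + ennreal (M \<bar>x t / r\<bar>) \<partial>unit_leb)"
      by (intro nn_integral_cmult) measurable
    also have "(\<integral>\<^sup>+t. 1 + ennreal (M \<bar>x t / r\<bar>) \<partial>unit_leb) = 1 + modular (\<lambda>t. x t / r)"
      unfolding orlicz_modular_def
      by (subst nn_integral_add) (auto simp: emeasure_unit_leb simp del: abs_divide)
    also have "ennreal (K * r) * (1 + modular (\<lambda>t. x t / r)) \<le> ennreal (K * r) * (1 + 1)"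
      using r by (intro mult_left_mono add_left_mono) auto
    also have "\<dots> = ennreal (2 * K * r)"
      using r K by (simp add: ennreal_mult'' mult_ac)
    finally show "(\<integral>\<^sup>+t. ennreal \<bar>x t\<bar> \<partial>unit_leb) \<le> ennreal (2 * K * r)" .
  qed
qed

lemma norm_0_imp_AE:
  assumes "x \<in> elems E" "fnorm E x = 0"
  shows "AE t in unit_leb. x t = 0"
proof -
  obtain K where K: "K > 0" "\<And>x r. x \<in> elems E \<Longrightarrow> fnorm E x < r \<Longrightarrow> (\<integral>\<^sup>+t. ennreal \<bar>x t\<bar> \<partial>unit_leb) \<le> ennreal (K * r)"
    using L1_le_norm by blast
  have [measurable]: "x \<in> borel_measurable unit_leb" using assms by (auto simp: elems_iff)
  have "(\<integral>\<^sup>+t. ennreal \<bar>x t\<bar> \<partial>unit_leb) \<le> 0"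
  proof (rule ennreal_le_epsilon)
    fix e :: real assume "e > 0"
    then show "(\<integral>\<^sup>+t. ennreal \<bar>x t\<bar> \<partial>unit_leb) \<le> 0 + ennreal e"
      using K(2)[OF assms(1), of "e / K"] K(1) assms(2) by simp
  qed
  then have "(\<integral>\<^sup>+t. ennreal \<bar>x t\<bar> \<partial>unit_leb) = 0" by simp
  then show ?thesis by (subst (asm) nn_integral_0_iff_AE) auto
qed

text \<open>A Cauchy sequence converges almost everywhere along a subsequence by the embedding into
  \<open>L\<^sub>1\<close>, and Fatou's lemma turns this into convergence in norm.\<close>

lemma complete:
  fixes f :: "nat \<Rightarrow> real \<Rightarrow> real"
  assumes f: "\<And>m. f m \<in> elems E"
    and cauchy: "\<And>\<epsilon>. \<epsilon> > 0 \<Longrightarrow> \<exists>N. \<forall>m\<ge>N. \<forall>k\<ge>N. fnorm E (\<lambda>t. f m t - f k t) < \<epsilon>"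
  shows "\<exists>g\<in>elems E. (\<lambda>m. fnorm E (\<lambda>t. f m t - g t)) \<longlonglongrightarrow> 0"
proof -
  obtain K where K: "K > 0" "\<And>x r. x \<in> elems E \<Longrightarrow> fnorm E x < r \<Longrightarrow> (\<integral>\<^sup>+t. ennreal \<bar>x t\<bar> \<partial>unit_leb) \<le> ennreal (K * r)"
    using L1_le_norm by blast
  have [measurable]: "f m \<in> borel_measurable unit_leb" for m using f by (auto simp: elems_iff)
  have int: "integrable unit_leb x" if "x \<in> elems E" for x
    using that K(2)[OF that, of "fnorm E x + 1"]
    by (intro integrableI_bounded) (auto simp: elems_iff intro: le_less_trans)
  have "\<exists>N. \<forall>m\<ge>N. \<forall>k\<ge>N. (LINT t|unit_leb. norm (f m t - f k t)) < \<epsilon>" if "\<epsilon> > 0" for \<epsilon>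
  proof -
    obtain N where N: "\<And>m k. m \<ge> N \<Longrightarrow> k \<ge> N \<Longrightarrow> fnorm E (\<lambda>t. f m t - f k t) < \<epsilon> / (2 * K)"
    proof -
      have "\<epsilon> / (2 * K) > 0" using \<open>\<epsilon> > 0\<close> K(1) by simp
      from cauchy[OF this] show thesis using that by blast
    qed
    have "(LINT t|unit_leb. norm (f m t - f k t)) < \<epsilon>" if "m \<ge> N" "k \<ge> N" for m k
    proof -
      have "ennreal (LINT t|unit_leb. \<bar>f m t - f k t\<bar>) = (\<integral>\<^sup>+t. ennreal \<bar>f m t - f k t\<bar> \<partial>unit_leb)"
        using int[OF elems_diff[OF f f]] by (intro nn_integral_eq_integral[symmetric]) auto
      also have "\<dots> \<le> ennreal (K * (\<epsilon> / (2 * K)))" by (intro K elems_diff f N that)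
      finally have "(LINT t|unit_leb. \<bar>f m t - f k t\<bar>) \<le> \<epsilon> / 2"
        using K(1) \<open>\<epsilon> > 0\<close> by (simp add: field_simps)
      then show ?thesis using \<open>\<epsilon> > 0\<close> by simp
    qed
    then show ?thesis by blast
  qed
  then obtain r where r: "strict_mono r" "AE t in unit_leb. Cauchy (\<lambda>i. f (r i) t)"
    using cauchy_L1_AE_cauchy_subseq[of unit_leb f] int[OF f] by blast
  define g where "g t = lim (\<lambda>i. f (r i) t)" for t
  have [measurable]: "g \<in> borel_measurable unit_leb" unfolding g_def by measurable
  have conv: "AE t in unit_leb. (\<lambda>i. f (r i) t) \<longlonglongrightarrow> g t"
    using r(2) by eventually_elim (auto simp: g_def Cauchy_convergent_iff convergent_LIMSEQ_iff)
  \<comment> \<open>The limit \<open>g\<close> is not yet known to belong to the space, so the bound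
    is first obtained for the modular, by lower semicontinuity along the subsequence.\<close>
  have mod: "modular (\<lambda>t. (f m t - g t) / \<epsilon>) \<le> 1"
    if "\<epsilon> > 0" and N: "\<And>k. k \<ge> N \<Longrightarrow> fnorm E (\<lambda>t. f m t - f k t) < \<epsilon>" for \<epsilon> m N
  proof -
    have "modular (\<lambda>t. (f m t - g t) / \<epsilon>) \<le>
        (\<integral>\<^sup>+t. liminf (\<lambda>i. ennreal (M \<bar>(f m t - f (r i) t) / \<epsilon>\<bar>)) \<partial>unit_leb)"
      unfolding orlicz_modular_def
    proof (rule nn_integral_mono_AE, use conv in eventually_elim)
      case (elim t)
      have "(\<lambda>i. (f m t - f (r i) t) / \<epsilon>) \<longlonglongrightarrow> (f m t - g t) / \<epsilon>"
        using \<open>\<epsilon> > 0\<close> elim by (intro tendsto_intros) auto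
      then have "(\<lambda>i. M \<bar>(f m t - f (r i) t) / \<epsilon>\<bar>) \<longlonglongrightarrow> M \<bar>(f m t - g t) / \<epsilon>\<bar>"
        by (rule continuous_on_tendsto_compose[OF M_abs_continuous]) auto
      then have "(\<lambda>i. ennreal (M \<bar>(f m t - f (r i) t) / \<epsilon>\<bar>)) \<longlonglongrightarrow> ennreal (M \<bar>(f m t - g t) / \<epsilon>\<bar>)"
        by (rule tendsto_ennrealI)
      then show ?case by (simp add: lim_imp_Liminf)
    qed
    also have "\<dots> \<le> liminf (\<lambda>i. modular (\<lambda>t. (f m t - f (r i) t) / \<epsilon>))"
      unfolding orlicz_modular_def by (intro nn_integral_liminf) measurable
    also have "\<dots> \<le> 1"
    proof (rule Liminf_le)
      show "\<forall>\<^sub>F i in sequentially. modular (\<lambda>t. (f m t - f (r i) t) / \<epsilon>) \<le> 1"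
        using eventually_ge_at_top[of N]
      proof eventually_elim
        case (elim i)
        then have "r i \<ge> N" using seq_suble[OF r(1), of i] by simp
        then show ?case by (intro modular_le_of_norm_less elems_diff f N)
      qed
    qed simp
    finally show ?thesis .
  qed
  have diff: "(\<lambda>t. f m t - g t) \<in> elems E \<and> fnorm E (\<lambda>t. f m t - g t) \<le> \<epsilon>"
    if "\<epsilon> > 0" and N: "\<And>k. k \<ge> N \<Longrightarrow> fnorm E (\<lambda>t. f m t - f k t) < \<epsilon>" for \<epsilon> m N
    using elems_norm_le[of "\<lambda>t. f m t - g t" \<epsilon> 1] mod[OF that] that(1) by simp
  obtain N where "\<And>k. k \<ge> N \<Longrightarrow> fnorm E (\<lambda>t. f N t - f k t) < 1" using cauchy[of 1] by auto
  then have "(\<lambda>t. f N t - g t) \<in> elems E" using diff[of 1 N N] by simp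
  from elems_diff[OF f[of N] this] have g: "g \<in> elems E" by simp
  have "(\<lambda>m. fnorm E (\<lambda>t. f m t - g t)) \<longlonglongrightarrow> 0"
  proof (rule LIMSEQ_I)
    fix \<epsilon> :: real assume "\<epsilon> > 0"
    then obtain N where N: "\<And>m k. m \<ge> N \<Longrightarrow> k \<ge> N \<Longrightarrow> fnorm E (\<lambda>t. f m t - f k t) < \<epsilon> / 2"
      using cauchy[of "\<epsilon> / 2"] by auto
    have "norm (fnorm E (\<lambda>t. f m t - g t) - 0) < \<epsilon>" if "m \<ge> N" for m
      using diff[of "\<epsilon> / 2" N m] N[OF that] \<open>\<epsilon> > 0\<close> norm_nonneg[OF elems_diff[OF f g, of m]] by auto
    then show "\<exists>N. \<forall>m\<ge>N. norm (fnorm E (\<lambda>t. f m t - g t) - 0) < \<epsilon>" by blast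
  qed
  with g show ?thesis by blast
qed

lemma banach_fspace_orlicz: "banach_fspace E"
  unfolding banach_fspace_def
proof (intro conjI ballI allI impI)
  show "elems E \<subseteq> borel_measurable unit_leb" using elems_measurable by blast
  show "(\<lambda>t. 0) \<in> elems E" using elems_AE_0[of "\<lambda>_. 0"] by simp
  fix x assume x: "x \<in> elems E"
  show "0 \<le> fnorm E x" using x by (rule norm_nonneg)
  show "(fnorm E x = 0) = (AE t in unit_leb. x t = 0)"
    using norm_0_imp_AE[OF x] elems_AE_0(2)[OF elems_measurable[OF x]] by blast
  show "(\<lambda>t. a * x t) \<in> elems E" "fnorm E (\<lambda>t. a * x t) = \<bar>a\<bar> * fnorm E x" for a
    using x by (rule elems_cmult_le norm_cmult)+
  fix y assume "y \<in> elems E"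
  with x show "(\<lambda>t. x t + y t) \<in> elems E" "fnorm E (\<lambda>t. x t + y t) \<le> fnorm E x + fnorm E y"
    by (rule elems_add)+
qed (use complete in blast)

section \<open>Rearrangement invariance\<close>

text \<open>\<open>equimeasurable\<close> compares tails at positive levels only. Level 0 is reached
  by an increasing union over the levels \<open>1 / real (Suc k)\<close>, and negative levels give
  the whole interval. Thus the absolute values have the same distribution, which determines the
  modular.\<close>

lemma modular_equimeasurable:
  assumes [measurable]: "x \<in> borel_measurable unit_leb" "y \<in> borel_measurable unit_leb"
    and eq: "equimeasurable x y"
  shows "modular (\<lambda>t. x t / r) = modular (\<lambda>t. y t / r)"
proof -
  have fin: "emeasure unit_leb A < \<infinity>" for A
    using emeasure_space[of unit_leb A] emeasure_unit_leb by (auto intro: le_less_trans)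
  have pos: "emeasure unit_leb {t \<in> {0..1}. \<bar>x t\<bar> > \<tau>} = emeasure unit_leb {t \<in> {0..1}. \<bar>y t\<bar> > \<tau>}"
    if "\<tau> > 0" for \<tau>
    using eq that fin[THEN less_imp_neq] unfolding equimeasurable_def
    by (simp add: emeasure_eq_ennreal_measure)
  have tail: "emeasure unit_leb {t \<in> {0..1}. \<bar>x t\<bar> > \<tau>} = emeasure unit_leb {t \<in> {0..1}. \<bar>y t\<bar> > \<tau>}" for \<tau>
  proof -
    consider "\<tau> > 0" | "\<tau> = 0" | "\<tau> < 0" by linarith
    then show ?thesis
    proof cases
      case 2
      have *: "emeasure unit_leb {t \<in> {0..1}. \<bar>z t\<bar> > 0} =
          (SUP k. emeasure unit_leb {t \<in> {0..1}. \<bar>z t\<bar> > 1 / real (Suc k)})"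
        if [measurable]: "z \<in> borel_measurable unit_leb" for z
      proof -
        have "{t \<in> {0..1}. \<bar>z t\<bar> > 0} = (\<Union>k. {t \<in> {0..1}. \<bar>z t\<bar> > 1 / real (Suc k)})"
        proof (intro set_eqI iffI)
          fix t assume "t \<in> {t \<in> {0..1}. \<bar>z t\<bar> > 0}"
          then obtain k where "inverse (real (Suc k)) < \<bar>z t\<bar>" "t \<in> {0..1}"
            using reals_Archimedean[of "\<bar>z t\<bar>"] by auto
          then show "t \<in> (\<Union>k. {t \<in> {0..1}. \<bar>z t\<bar> > 1 / real (Suc k)})"
            by (auto simp: inverse_eq_divide)
        qed (auto intro: less_trans[rotated])
        moreover have "{t \<in> {0..1}. \<bar>z t\<bar> > 1 / real (Suc k)} \<in> sets unit_leb" for k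
        proof -
          have "{t \<in> space unit_leb. \<bar>z t\<bar> > 1 / real (Suc k)} \<in> sets unit_leb" by measurable
          then show ?thesis by (simp add: space_restrict_space)
        qed
        moreover have "incseq (\<lambda>k. {t \<in> {0..1}. \<bar>z t\<bar> > 1 / real (Suc k)})"
        proof (rule incseq_SucI, clarify)
          fix k t assume "1 / real (Suc k) < \<bar>z t\<bar>"
          moreover have "1 / real (Suc (Suc k)) \<le> 1 / real (Suc k)" by (intro divide_left_mono) auto
          ultimately show "1 / real (Suc (Suc k)) < \<bar>z t\<bar>" by linarith
        qed
        ultimately show ?thesis by (simp add: SUP_emeasure_incseq image_subset_iff)
      qed
      show ?thesis unfolding 2 *[OF assms(1)] *[OF assms(2)]
        by (intro SUP_cong refl pos) simp
    next
      case 3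
      then have "{t \<in> {0..1}. \<bar>z t\<bar> > \<tau>} = {0..1}" for z :: "real \<Rightarrow> real"
        by (auto intro: less_le_trans)
      then show ?thesis by simp
    qed (use pos in auto)
  qed
  have "distr unit_leb borel (\<lambda>t. \<bar>x t\<bar>) = distr unit_leb borel (\<lambda>t. \<bar>y t\<bar>)"
    using tail
    by (intro measure_eqI_lessThan)
      (auto simp: emeasure_distr vimage_def space_restrict_space fin[simplified] Int_def conj_commute)
  then have "(\<integral>\<^sup>+u. ennreal (M \<bar>u / r\<bar>) \<partial>distr unit_leb borel (\<lambda>t. \<bar>x t\<bar>)) =
      (\<integral>\<^sup>+u. ennreal (M \<bar>u / r\<bar>) \<partial>distr unit_leb borel (\<lambda>t. \<bar>y t\<bar>))" by simp
  then have "(\<integral>\<^sup>+t. ennreal (M \<bar>\<bar>x t\<bar> / r\<bar>) \<partial>unit_leb) = (\<integral>\<^sup>+t. ennreal (M \<bar>\<bar>y t\<bar> / r\<bar>) \<partial>unit_leb)"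
    by (subst (asm) (1 2) nn_integral_distr) (auto simp del: abs_divide)
  then show ?thesis by (simp add: orlicz_modular_def)
qed

lemma ri_space_orlicz: "ri_space E"
  unfolding ri_space_def
proof (intro conjI ballI impI)
  show "banach_fspace E" by (rule banach_fspace_orlicz)
  have "modular (\<lambda>t. 1 / 1) \<le> ennreal (max 1 (M 1))"
    by (simp add: orlicz_modular_def emeasure_unit_leb ennreal_leI)
  then have one: "(\<lambda>t. 1) \<in> elems E" by (intro elems_norm_le(1)[of _ 1 "max 1 (M 1)"]) auto
  have "fnorm E (\<lambda>t. 1) \<noteq> 0"
  proof
    assume "fnorm E (\<lambda>t. 1) = 0"
    then have "AE t in unit_leb. False" using norm_0_imp_AE[OF one] by simp
    then have "{0..1} \<in> null_sets unit_leb" by (simp add: AE_iff_null_sets eventually_mono)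
    then have "emeasure unit_leb {0..1} = 0" by (rule null_setsD1)
    then show False by (simp add: emeasure_unit_leb)
  qed
  then show "\<exists>x\<in>elems E. fnorm E x \<noteq> 0" using one by blast
next
  fix x y :: "real \<Rightarrow> real"
  assume x: "x \<in> borel_measurable unit_leb" and y: "y \<in> elems E"
  \<comment> \<open>The ideal property and the membership of equimeasurable functions both reduce to
    comparing modulars at every scale.\<close>
  have mem: "x \<in> elems E \<and> fnorm E x \<le> fnorm E y"
    if "\<And>r. r > 0 \<Longrightarrow> modular (\<lambda>t. x t / r) \<le> modular (\<lambda>t. y t / r)"
  proof
    have *: "r > 0 \<and> modular (\<lambda>t. x t / r) \<le> 1" if "fnorm E y < r" for r
      using modular_le_of_norm_less[OF y that] \<open>\<And>r. r > 0 \<Longrightarrow> modular (\<lambda>t. x t / r) \<le> modular (\<lambda>t. y t / r)\<close>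
      by (auto intro: order_trans)
    from *[of "fnorm E y + 1"] show "x \<in> elems E" using x by (auto simp: elems_iff)
    show "fnorm E x \<le> fnorm E y"
    proof (rule dense_ge)
      fix r assume "fnorm E y < r"
      then show "fnorm E x \<le> r" using *[of r] by (simp add: norm_le)
    qed
  qed
  {
    assume "AE t in unit_leb. \<bar>x t\<bar> \<le> \<bar>y t\<bar>"
    then have "modular (\<lambda>t. x t / r) \<le> modular (\<lambda>t. y t / r)" if "r > 0" for r
      using that by (intro modular_mono_AE) (auto elim!: eventually_mono intro!: divide_right_mono)
    then show "x \<in> elems E" "fnorm E x \<le> fnorm E y" using mem by auto
  }
  assume "equimeasurable x y"
  then have eq: "modular (\<lambda>t. x t / r) = modular (\<lambda>t. y t / r)" for r
    using x elems_measurable[OF y] by (intro modular_equimeasurable)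
  then show "x \<in> elems E" using mem by simp
  show "fnorm E x = fnorm E y" by (simp add: norm_eq eq)
qed

section \<open>Modulars of step functions\<close>

text \<open>Covers \<open>T_op\<close> with \<open>N = fact n\<close> and \<open>U_op\<close> with
  \<open>N = n\<close>, so their modulars become finite averages. Outside the sets
  \<open>I s\<close> the function is 0 and contributes nothing because
  \<open>M 0 = 0\<close>.\<close>

lemma modular_step:
  assumes "finite S" "disjoint_family_on I S" "N > 0"
    and I: "\<And>s. s \<in> S \<Longrightarrow> I s \<in> sets lebesgue \<and> I s \<subseteq> {0..1} \<and> measure lebesgue (I s) = 1 / N"
    and r: "r > 0"
  shows "modular (\<lambda>t. (\<Sum>s\<in>S. v s * indicator (I s) t) / r) = ennreal ((\<Sum>s\<in>S. M (\<bar>v s\<bar> / r)) / N)"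
    and "(\<lambda>t. (\<Sum>s\<in>S. v s * indicator (I s) t)) \<in> elems E"
proof -
  have sets: "I s \<in> sets unit_leb" if "s \<in> S" for s
    using I[OF that] by (auto simp: sets_restrict_space image_iff intro!: bexI[of _ "I s"])
  have em: "emeasure unit_leb (I s) = ennreal (1 / N)" if "s \<in> S" for s
  proof -
    have "emeasure unit_leb (I s) = emeasure lebesgue (I s)"
      using I[OF that] by (simp add: emeasure_restrict_space)
    also have "emeasure lebesgue (I s) \<le> emeasure lebesgue {0..1::real}"
      using I[OF that] by (intro emeasure_mono) auto
    then have "emeasure lebesgue (I s) \<noteq> \<infinity>" by (auto simp: top_unique)
    then have "emeasure lebesgue (I s) = ennreal (measure lebesgue (I s))"
      by (simp add: emeasure_eq_ennreal_measure)
    finally show ?thesis using I[OF that] by simp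
  qed
  have pt: "M \<bar>(\<Sum>s\<in>S. v s * indicator (I s) t) / r\<bar> = (\<Sum>s\<in>S. M (\<bar>v s\<bar> / r) * indicator (I s) t)" for t
  proof (cases "\<exists>s\<in>S. t \<in> I s")
    case True
    then obtain s where s: "s \<in> S" "t \<in> I s" by blast
    then have "indicator (I s') t = (if s' = s then 1 else 0 :: real)" if "s' \<in> S" for s'
      using assms(2) that by (auto simp: disjoint_family_on_def indicator_def)
    then show ?thesis using assms(1) s r by (simp add: if_distrib[of "\<lambda>z. _ * z"] cong: if_cong)
  qed auto
  have "modular (\<lambda>t. (\<Sum>s\<in>S. v s * indicator (I s) t) / r) =
      (\<integral>\<^sup>+t. (\<Sum>s\<in>S. ennreal (M (\<bar>v s\<bar> / r)) * indicator (I s) t) \<partial>unit_leb)"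
    unfolding orlicz_modular_def pt using r
    by (intro nn_integral_cong) (auto simp: M_nonneg ennreal_mult' simp flip: sum_ennreal ennreal_indicator)
  also have "\<dots> = (\<Sum>s\<in>S. ennreal (M (\<bar>v s\<bar> / r)) * ennreal (1 / N))"
    using sets em by (subst nn_integral_sum) (auto intro!: sum.cong simp: nn_integral_cmult_indicator)
  also have "\<dots> = ennreal ((\<Sum>s\<in>S. M (\<bar>v s\<bar> / r)) / N)"
    using r assms(3) by (simp add: M_nonneg sum_divide_distrib flip: ennreal_mult' sum_ennreal)
  finally show eq: "modular (\<lambda>t. (\<Sum>s\<in>S. v s * indicator (I s) t) / r) = ennreal ((\<Sum>s\<in>S. M (\<bar>v s\<bar> / r)) / N)" .
  show "(\<lambda>t. (\<Sum>s\<in>S. v s * indicator (I s) t)) \<in> elems E"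
  proof (rule elems_norm_le(1)[OF _ r])
    show "(\<lambda>t. \<Sum>s\<in>S. v s * indicator (I s) t) \<in> borel_measurable unit_leb"
      using sets by (intro borel_measurable_sum borel_measurable_times borel_measurable_const
        borel_measurable_indicator)
    show "modular (\<lambda>t. (\<Sum>s\<in>S. v s * indicator (I s) t) / r) \<le>
        ennreal (max 1 ((\<Sum>s\<in>S. M (\<bar>v s\<bar> / r)) / N))"
      unfolding eq by (intro ennreal_leI) simp
  qed simp
qed

lemma T_op_modular:
  assumes l: "bij_betw l {\<pi>. \<pi> permutes {1..n}} {1..fact n}" and r: "r > 0"
  shows "modular (\<lambda>t. T_op q n l x t / r) = ennreal ((\<Sum>\<pi> | \<pi> permutes {1..n}.
      M ((\<Sum>i=1..n. \<bar>x i (\<pi> i)\<bar> powr q) powr (1 / q) / r)) / fact n)"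
    and "T_op q n l x \<in> elems E"
proof -
  let ?P = "{\<pi>. \<pi> permutes {1..n}}"
  define I where "I \<pi> = {(real (l \<pi>) - 1) / fact n ..< real (l \<pi>) / fact n}" for \<pi>
  have fin: "finite ?P" by (intro finite_permutations) simp
  have lm: "1 \<le> l \<pi> \<and> l \<pi> \<le> fact n" if "\<pi> \<in> ?P" for \<pi>
    using bij_betwE[OF l] that by auto
  have disj: "disjoint_family_on I ?P"
    unfolding disjoint_family_on_def
  proof (intro ballI impI)
    fix \<pi> \<rho> assume *: "\<pi> \<in> ?P" "\<rho> \<in> ?P" "\<pi> \<noteq> \<rho>"
    then have "l \<pi> \<noteq> l \<rho>" using l by (auto simp: bij_betw_def inj_on_def)
    then have "real (l \<pi>) \<le> real (l \<rho>) - 1 \<or> real (l \<rho>) \<le> real (l \<pi>) - 1" by linarith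
    then have "real (l \<pi>) / fact n \<le> (real (l \<rho>) - 1) / fact n \<or>
        real (l \<rho>) / fact n \<le> (real (l \<pi>) - 1) / fact n"
      by (auto intro: divide_right_mono)
    then show "I \<pi> \<inter> I \<rho> = {}" unfolding I_def by fastforce
  qed
  have I: "I \<pi> \<in> sets lebesgue \<and> I \<pi> \<subseteq> {0..1} \<and> measure lebesgue (I \<pi>) = 1 / fact n" if "\<pi> \<in> ?P" for \<pi>
  proof (intro conjI)
    show "I \<pi> \<subseteq> {0..1}"
    proof
      fix t assume t: "t \<in> I \<pi>"
      have "real (l \<pi>) \<le> fact n" using lm[OF that] by (metis of_nat_fact of_nat_le_iff)
      then have "real (l \<pi>) / fact n \<le> 1" by simp
      moreover have "0 \<le> (real (l \<pi>) - 1) / fact n" using lm[OF that] by simp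
      ultimately show "t \<in> {0..1}" using t
        unfolding I_def atLeastLessThan_iff atLeastAtMost_iff by linarith
    qed
    show "measure lebesgue (I \<pi>) = 1 / fact n" by (simp add: I_def divide_right_mono diff_divide_distrib)
  qed (simp add: I_def)
  have T: "T_op q n l x = (\<lambda>t. \<Sum>\<pi>\<in>?P. (\<Sum>i=1..n. \<bar>x i (\<pi> i)\<bar> powr q) powr (1 / q) * indicator (I \<pi>) t)"
    by (simp add: T_op_def I_def fun_eq_iff)
  show "modular (\<lambda>t. T_op q n l x t / r) = ennreal ((\<Sum>\<pi>\<in>?P.
      M ((\<Sum>i=1..n. \<bar>x i (\<pi> i)\<bar> powr q) powr (1 / q) / r)) / fact n)"
    unfolding T by (subst modular_step(1)[OF fin disj _ I r]) auto
  show "T_op q n l x \<in> elems E"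
    unfolding T by (rule modular_step(2)[OF fin disj _ I r]) auto
qed

lemma U_op_modular:
  assumes "n > 0" and r: "r > 0"
  shows "modular (\<lambda>t. U_op n x t / r) = ennreal ((\<Sum>k=1..n. M (\<bar>decr_rearr n x k\<bar> / r)) / n)"
    and "U_op n x \<in> elems E"
proof -
  define I where "I k = {(real k - 1) / real n <..< real k / real n}" for k
  have disj: "disjoint_family_on I {1..n}"
    unfolding disjoint_family_on_def
  proof (intro ballI impI)
    fix k m assume "k \<in> {1..n}" "m \<in> {1..n}" "k \<noteq> m"
    then have "real k \<le> real m - 1 \<or> real m \<le> real k - 1" by linarith
    then show "I k \<inter> I m = {}" using assms by (auto simp: I_def field_simps)
  qed
  have I: "I k \<in> sets lebesgue \<and> I k \<subseteq> {0..1} \<and> measure lebesgue (I k) = 1 / real n" if "k \<in> {1..n}" for k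
  proof (intro conjI)
    show "I k \<subseteq> {0..1}"
    proof
      fix t assume t: "t \<in> I k"
      have "real k / real n \<le> 1" "0 \<le> (real k - 1) / real n" using that by simp_all
      then show "t \<in> {0..1}" using t by (simp add: I_def)
    qed
    show "measure lebesgue (I k) = 1 / real n" by (simp add: I_def divide_right_mono diff_divide_distrib)
  qed (simp add: I_def)
  have U: "U_op n x = (\<lambda>t. \<Sum>k\<in>{1..n}. decr_rearr n x k * indicator (I k) t)"
    by (simp add: U_op_def I_def fun_eq_iff)
  show "modular (\<lambda>t. U_op n x t / r) = ennreal ((\<Sum>k=1..n. M (\<bar>decr_rearr n x k\<bar> / r)) / n)"
    unfolding U using assms by (subst modular_step(1)[OF _ disj _ I r]) auto
  show "U_op n x \<in> elems E"
    unfolding U using assms by (intro modular_step(2)[OF _ disj _ I r]) auto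
qed

end

subsection \<open>Orlicz functions of exponential type\<close>

text \<open>\<open>powr_convex\<close> treats positive arguments; if one of them is 0, the claim
  reduces to \<open>c powr p \<le> c\<close> for \<open>c\<close> in the unit interval.\<close>

lemma convex_on_atLeast_powr:
  assumes "1 \<le> p"
  shows "convex_on {0..} (\<lambda>x::real. x powr p)"
proof (rule convex_onI)
  fix t x y :: real assume t: "0 < t" "t < 1" and xy: "x \<in> {0..}" "y \<in> {0..}"
  have scale: "(c * z) powr p \<le> c * z powr p" if "0 \<le> c" "c \<le> 1" "0 \<le> z" for c z :: real
    using powr_mono'[of 1 p c] that assms by (auto simp: powr_mult intro!: mult_right_mono)
  consider "x = 0" | "y = 0" | "x > 0" "y > 0" using xy by force
  then show "((1 - t) *\<^sub>R x + t *\<^sub>R y) powr p \<le> (1 - t) * x powr p + t * y powr p"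
  proof cases
    case 3
    then show ?thesis using convex_onD[OF powr_convex[OF assms], of t x y] t by simp
  qed (use t xy assms scale[of t y] scale[of "1 - t" x] in auto)
qed simp

lemma convex_orlicz_M_exp:
  assumes "1 \<le> p"
  shows "convex_orlicz_function (M_exp p)"
  unfolding convex_orlicz_function_def
proof (intro conjI)
  show "M_exp p 0 = 0" by (simp add: M_exp_def)
  show "mono_on {0..} (M_exp p)"
    using assms by (auto simp: M_exp_def intro!: mono_onI powr_mono2)
  show "convex_on {0..} (M_exp p)"
  proof (rule convex_onI)
    fix t x y :: real assume t: "0 < t" "t < 1" and xy: "x \<in> {0..}" "y \<in> {0..}"
    have "exp (((1 - t) *\<^sub>R x + t *\<^sub>R y) powr p) \<le> exp ((1 - t) * x powr p + t * y powr p)"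
      using convex_onD[OF convex_on_atLeast_powr[OF assms], of t x y] t xy by simp
    also have "\<dots> \<le> (1 - t) * exp (x powr p) + t * exp (y powr p)"
      using convex_onD[OF exp_convex, of t "x powr p" "y powr p"] t by simp
    finally have *: "exp (((1 - t) *\<^sub>R x + t *\<^sub>R y) powr p) \<le> (1 - t) * exp (x powr p) + t * exp (y powr p)" .
    show "M_exp p ((1 - t) *\<^sub>R x + t *\<^sub>R y) \<le> (1 - t) * M_exp p x + t * M_exp p y"
    proof -
      have "0 \<le> (1 - t) * x + t * y" using t xy by simp
      then show ?thesis using * xy by (simp add: M_exp_def right_diff_distrib left_diff_distrib)
    qed
  qed simp
qed

text \<open>The additive \<open>K\<close> absorbs a bounded range of arguments, about which
  equivalence at infinity says nothing. It lets the two-sided estimate treat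
  \<open>p \<ge> 1\<close> and \<open>p < 1\<close> alike; \<open>a \<le> 1\<close> is arranged for
  \<open>exp_moment_T_val\<close>.\<close>

lemma generates_exp_L_bounds:
  assumes "0 < p" "generates_exp_L p M"
  shows "orlicz M"
    and "\<exists>a b K. 0 < a \<and> a \<le> 1 \<and> 0 < b \<and> 0 \<le> K \<and>
      (\<forall>u\<ge>0. exp ((a * u) powr p) - 1 \<le> K + M u \<and> M u \<le> exp ((b * u) powr p) + K)"
proof -
  have conv: "convex_orlicz_function M" and eq: "equivalent_at_infinity M (M_exp p)"
    using assms convex_orlicz_M_exp
    by (auto simp: generates_exp_L_def equivalent_at_infinity_def intro!: exI[of _ "1::real"] split: if_splits)
  then obtain a' b u0 where ab: "a' > 0" "b > 0"
    and le: "\<And>u. u \<ge> u0 \<Longrightarrow> M_exp p (a' * u) \<le> M u \<and> M u \<le> M_exp p (b * u)"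
    by (auto simp: equivalent_at_infinity_def)
  have mono: "M u \<le> M v" if "0 \<le> u" "u \<le> v" for u v
    using conv that by (auto simp: convex_orlicz_function_def mono_on_def)
  have M0: "M 0 = 0" using conv by (auto simp: convex_orlicz_function_def)
  \<comment> \<open>At least 1, so that \<open>M_exp p (a' * u1)\<close> is positive, which makes
    \<open>M\<close> nontrivial.\<close>
  define u1 where "u1 = max 1 u0"
  have "0 < M_exp p (a' * u1)" using ab by (simp add: M_exp_def u1_def)
  also have "\<dots> \<le> M u1" using le[of u1] by (simp add: u1_def)
  finally have "0 < M u1" .
  then show "orlicz M" using conv by unfold_locales (auto simp: u1_def intro!: exI[of _ "max 1 u0"])
  define a where "a = min 1 a'"
  have a: "0 < a" "a \<le> 1" "a \<le> a'" using ab by (auto simp: a_def)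
  \<comment> \<open>Below \<open>u1\<close> the first summand bounds \<open>M\<close> and the second
    bounds the exponential.\<close>
  define K where "K = M u1 + exp ((a * u1) powr p)"
  have "0 \<le> K" using \<open>0 < M u1\<close> by (simp add: K_def add_nonneg_nonneg)
  have "exp ((a * u) powr p) - 1 \<le> K + M u \<and> M u \<le> exp ((b * u) powr p) + K" if u: "u \<ge> 0" for u
  proof (cases "u \<ge> u1")
    case True
    then have "exp ((a * u) powr p) - 1 \<le> M_exp p (a' * u)"
      using a u assms(1) ab by (auto simp: M_exp_def abs_mult intro!: powr_mono2 mult_right_mono)
    moreover have "M_exp p (b * u) \<le> exp ((b * u) powr p)" using u ab by (simp add: M_exp_def)
    ultimately show ?thesis using le[of u] True \<open>0 \<le> K\<close> unfolding u1_def by auto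
  next
    case False
    then have "exp ((a * u) powr p) \<le> exp ((a * u1) powr p)"
      using a u assms(1) by (auto intro!: powr_mono2 mult_left_mono)
    moreover have "M u \<le> M u1" "0 \<le> M u" using mono[of u u1] mono[of 0 u] M0 False u by auto
    moreover have "0 < exp ((b * u) powr p)" "0 < exp ((a * u1) powr p)" by simp_all
    ultimately show ?thesis using \<open>0 < M u1\<close> unfolding K_def by linarith
  qed
  then show "\<exists>a b K. 0 < a \<and> a \<le> 1 \<and> 0 < b \<and> 0 \<le> K \<and>
      (\<forall>u\<ge>0. exp ((a * u) powr p) - 1 \<le> K + M u \<and> M u \<le> exp ((b * u) powr p) + K)"
    using a ab \<open>0 \<le> K\<close> by blast
qed

subsection \<open>Moments and tails of the values of the operators\<close>

text \<open>The value of \<open>T_op\<close> on the interval that the enumeration \<open>l\<close>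
  assigns to \<open>\<pi>\<close>; passing to it removes \<open>l\<close> from the
  estimates.\<close>

definition T_val :: "real \<Rightarrow> nat \<Rightarrow> (nat \<Rightarrow> nat \<Rightarrow> real) \<Rightarrow> (nat \<Rightarrow> nat) \<Rightarrow> real" where
  "T_val q n x \<pi> = (\<Sum>i=1..n. \<bar>x i (\<pi> i)\<bar> powr q) powr (1 / q)"

lemma T_val_nonneg: "0 \<le> T_val q n x \<pi>"
  by (simp add: T_val_def)

lemma T_val_powr: "0 < q \<Longrightarrow> T_val q n x \<pi> powr q = (\<Sum>i=1..n. \<bar>x i (\<pi> i)\<bar> powr q)"
  by (simp add: T_val_def powr_powr sum_nonneg)

lemma entry_le_T_val:
  assumes "0 < q" "i \<in> {1..n}"
  shows "\<bar>x i (\<pi> i)\<bar> \<le> T_val q n x \<pi>"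
proof -
  have "\<bar>x i (\<pi> i)\<bar> powr q \<le> (\<Sum>i=1..n. \<bar>x i (\<pi> i)\<bar> powr q)"
    using assms(2) by (intro member_le_sum) auto
  then have "(\<bar>x i (\<pi> i)\<bar> powr q) powr (1 / q) \<le> T_val q n x \<pi>"
    unfolding T_val_def using assms by (intro powr_mono2) auto
  then show ?thesis using assms by (simp add: powr_powr)
qed

lemma sum_split_upto_square:
  fixes f :: "nat \<Rightarrow> real"
  shows "(\<Sum>k=1..n\<^sup>2. f k) = (\<Sum>k=1..n. f k) + (\<Sum>k=n+1..n\<^sup>2. f k)"
proof -
  have n: "n \<le> n\<^sup>2" by (simp add: power2_eq_square)
  have "{1..n\<^sup>2} = {1..n} \<union> {n+1..n\<^sup>2}" using n by auto
  then show ?thesis by (simp add: sum.union_disjoint)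
qed

text \<open>With \<open>s = p / q < 1\<close>, the function \<open>min z (z powr s)\<close> of \<open>z = (a u / L) powr q\<close> is at most
  \<open>z powr s = (a u / L) powr p\<close>, which is used for the \<open>n\<close> largest entries, and at most \<open>z\<close>, which
  is used for the others.\<close>

lemma exp_moment_T_val:
  assumes pq: "0 < p" "p < q" and n: "1 \<le> n" and L: "0 < L" and a: "0 < a" "a \<le> 1"
    and top: "(\<Sum>k=1..n. exp ((a * decr_rearr n x k / L) powr p) - 1) \<le> real n * K"
    and mid: "decr_rearr n x n \<le> L"
    and rest: "(\<Sum>k=n+1..n\<^sup>2. decr_rearr n x k powr q) \<le> real n * L powr q"
  shows "(\<Sum>\<pi> | \<pi> permutes {1..n}. exp ((a * T_val q n x \<pi> / L) powr p)) / fact n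
    \<le> exp (1 + exp 1 * (K + 2))"
proof -
  let ?y = "decr_rearr n x"
  define s where "s = p / q"
  have s: "0 < s" "s < 1" "q * s = p" using pq by (auto simp: s_def)
  define z where "z u = (a * u / L) powr q" for u
  define \<phi> where "\<phi> u = min (z u) (z u powr s)" for u
  have z0: "0 \<le> z u" for u by (simp add: z_def)
  have \<phi>0: "0 \<le> \<phi> u" for u by (simp add: \<phi>_def z0)
  have zs: "z u powr s = (a * u / L) powr p" for u by (simp add: z_def powr_powr s)
  have ny: "n \<le> n\<^sup>2" by (simp add: power2_eq_square)
  \<comment> \<open>The leading 1 of \<open>one_plus_sum_powr_le\<close> becomes the factor
    \<open>exp 1\<close>; what remains is a product over rows, as
    \<open>mean_permutes_prod_le\<close> requires.\<close>
  have T: "exp ((a * T_val q n x \<pi> / L) powr p) \<le> exp 1 * (\<Prod>i=1..n. 1 + (exp (\<phi> \<bar>x i (\<pi> i)\<bar>) - 1))" for \<pi>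
  proof -
    have "(a * T_val q n x \<pi> / L) powr q = (\<Sum>i=1..n. z \<bar>x i (\<pi> i)\<bar>)"
      using a L pq T_val_nonneg[of q n x \<pi>] T_val_powr[of q n x \<pi>]
      by (simp add: z_def powr_mult powr_divide sum_distrib_left sum_divide_distrib)
    then have "(a * T_val q n x \<pi> / L) powr p = (\<Sum>i=1..n. z \<bar>x i (\<pi> i)\<bar>) powr s"
      by (metis powr_powr s(3))
    also have "\<dots> \<le> (1 + (\<Sum>i=1..n. z \<bar>x i (\<pi> i)\<bar>)) powr s"
      using s by (intro powr_mono2) (auto intro: sum_nonneg z0)
    also have "\<dots> \<le> 1 + (\<Sum>i=1..n. \<phi> \<bar>x i (\<pi> i)\<bar>)"
      unfolding \<phi>_def using s by (intro one_plus_sum_powr_le z0) auto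
    finally have "exp ((a * T_val q n x \<pi> / L) powr p) \<le> exp (1 + (\<Sum>i=1..n. \<phi> \<bar>x i (\<pi> i)\<bar>))" by simp
    then show ?thesis by (simp add: exp_add exp_sum)
  qed
  \<comment> \<open>Past the \<open>n\<close>-th entry, \<open>mid\<close> gives
    \<open>z \<le> 1\<close>, where the exponential lies below its chord; the factor 2 bounds
    \<open>exp 1 - 1\<close>.\<close>
  have small: "exp (\<phi> (?y k)) - 1 \<le> 2 * (?y k powr q / L powr q)" if k: "k \<in> {n+1..n\<^sup>2}" for k
  proof -
    have y: "0 \<le> ?y k" "?y k \<le> L"
      using k n decr_rearr_nonneg[of k n x] decr_rearr_antimono[of n k n x] mid by auto
    have "a * ?y k / L \<le> ?y k / L" using a y L mult_right_mono[of a 1 "?y k"] by (simp add: divide_right_mono)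
    then have zle: "z (?y k) \<le> (?y k / L) powr q"
      unfolding z_def using a y L pq by (intro powr_mono2) auto
    also have "\<dots> \<le> 1" using y L pq by (intro powr_le1) auto
    finally have z1: "z (?y k) \<le> 1" .
    have "exp (\<phi> (?y k)) - 1 \<le> exp (z (?y k) * 1) - 1" by (simp add: \<phi>_def)
    also have "\<dots> \<le> z (?y k) * (exp 1 - 1)" by (rule exp_le_chord[OF z0 z1])
    also have "\<dots> \<le> z (?y k) * 2" using exp_le z0 by (intro mult_left_mono) auto
    finally show ?thesis using zle y L by (simp add: powr_divide)
  qed
  have "(\<Sum>k=1..n\<^sup>2. exp (\<phi> (?y k)) - 1) \<le>
      (\<Sum>k=1..n. exp ((a * ?y k / L) powr p) - 1) + (\<Sum>k=n+1..n\<^sup>2. 2 * (?y k powr q / L powr q))"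
    unfolding sum_split_upto_square
    by (intro add_mono sum_mono small) (auto simp: \<phi>_def zs)
  also have "(\<Sum>k=n+1..n\<^sup>2. 2 * (?y k powr q / L powr q)) = 2 * (\<Sum>k=n+1..n\<^sup>2. ?y k powr q) / L powr q"
    by (simp add: sum_distrib_left sum_divide_distrib)
  also have "\<dots> \<le> 2 * (real n * L powr q) / L powr q"
    using rest by (intro divide_right_mono mult_left_mono) auto
  also have "\<dots> = 2 * real n" using L by simp
  \<comment> \<open>\<open>K\<close> comes from \<open>top\<close> and 2 from
    \<open>rest\<close>.\<close>
  finally have tot: "(\<Sum>k=1..n\<^sup>2. exp (\<phi> (?y k)) - 1) \<le> real n * (K + 2)"
    using top by (simp add: algebra_simps)
  have "(\<Sum>\<pi> | \<pi> permutes {1..n}. exp ((a * T_val q n x \<pi> / L) powr p)) / fact n \<le>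
      (\<Sum>\<pi> | \<pi> permutes {1..n}. exp 1 * (\<Prod>i=1..n. 1 + (exp (\<phi> \<bar>x i (\<pi> i)\<bar>) - 1))) / fact n"
    by (intro divide_right_mono sum_mono T) auto
  also have "\<dots> = exp 1 * ((\<Sum>\<pi> | \<pi> permutes {1..n}. \<Prod>i\<in>{1..n}. 1 + (exp (\<phi> \<bar>x i (\<pi> i)\<bar>) - 1)) / fact (card {1..n}))"
    by (simp add: sum_distrib_left)
  also have "\<dots> \<le> exp 1 * exp (exp 1 / card {1..n} * (\<Sum>i\<in>{1..n}. \<Sum>j\<in>{1..n}. exp (\<phi> \<bar>x i j\<bar>) - 1))"
    using n \<phi>0 by (intro mult_left_mono mean_permutes_prod_le) auto
  also have "(\<Sum>i\<in>{1..n}. \<Sum>j\<in>{1..n}. exp (\<phi> \<bar>x i j\<bar>) - 1) = (\<Sum>k=1..n\<^sup>2. exp (\<phi> (?y k)) - 1)"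
    by (rule sum_decr_rearr[symmetric])
  also have "exp 1 * exp (exp 1 / card {1..n} * (\<Sum>k=1..n\<^sup>2. exp (\<phi> (?y k)) - 1)) \<le>
      exp 1 * exp (exp 1 / card {1..n} * (real n * (K + 2)))"
    using tot by (intro mult_left_mono iffD2[OF exp_le_cancel_iff]) auto
  also have "\<dots> = exp (1 + exp 1 * (K + 2))" using n by (simp add: exp_add)
  finally show ?thesis .
qed

text \<open>Ties may leave more than \<open>n\<close> positions above the threshold; exactly
  \<open>k\<close> of them are kept to meet the size condition of
  \<open>permutes_hit_probability\<close>. \<open>Z\<close> is any majorant of the entries met by
  \<open>\<pi>\<close>, later \<open>T_val\<close>.\<close>

lemma tail_probability:
  assumes n: "1 \<le> n" and k: "1 \<le> k" "k \<le> n"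
    and Z: "\<And>\<pi> i. i \<in> {1..n} \<Longrightarrow> \<bar>x i (\<pi> i)\<bar> \<le> Z \<pi>"
  shows "real k / n \<le> hit_const * ((\<Sum>\<pi> | \<pi> permutes {1..n}. of_bool (decr_rearr n x k \<le> Z \<pi>)) / fact n)"
proof -
  have "k \<le> n\<^sup>2" using k by (metis le_trans power2_nat_le_imp_le le_square power2_eq_square)
  from card_ge_decr_rearr[OF k(1) this, of x] obtain B where
    B: "B \<subseteq> {(i, j) \<in> {1..n} \<times> {1..n}. decr_rearr n x k \<le> \<bar>x i j\<bar>}" "card B = k"
    by (meson obtain_subset_with_card_n)
  have fin: "finite {\<pi>. \<pi> permutes {1..n}}" by (intro finite_permutations) simp
  have "real k / n = card B / card {1..n}" using B by simp
  also have "\<dots> \<le> hit_const * (card {\<pi>. \<pi> permutes {1..n} \<and> (\<exists>i\<in>{1..n}. (i, \<pi> i) \<in> B)} / fact (card {1..n}))"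
    using B k by (intro permutes_hit_probability) auto
  also have "\<dots> \<le> hit_const * (card {\<pi> \<in> {\<pi>. \<pi> permutes {1..n}}. decr_rearr n x k \<le> Z \<pi>} / fact (card {1..n}))"
  proof -
    have "card {\<pi>. \<pi> permutes {1..n} \<and> (\<exists>i\<in>{1..n}. (i, \<pi> i) \<in> B)} \<le>
        card {\<pi> \<in> {\<pi>. \<pi> permutes {1..n}}. decr_rearr n x k \<le> Z \<pi>}"
    proof (intro card_mono subsetI)
      fix \<pi> assume "\<pi> \<in> {\<pi>. \<pi> permutes {1..n} \<and> (\<exists>i\<in>{1..n}. (i, \<pi> i) \<in> B)}"
      then obtain i where i: "\<pi> permutes {1..n}" "i \<in> {1..n}" "(i, \<pi> i) \<in> B" by blast
      then have "decr_rearr n x k \<le> \<bar>x i (\<pi> i)\<bar>" using B by auto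
      also have "\<dots> \<le> Z \<pi>" using i by (intro Z)
      finally show "\<pi> \<in> {\<pi> \<in> {\<pi>. \<pi> permutes {1..n}}. decr_rearr n x k \<le> Z \<pi>}" using i by simp
    qed (use fin in simp)
    then show ?thesis using hit_const_ge by (intro mult_left_mono divide_right_mono) auto
  qed
  also have "real (card {\<pi> \<in> {\<pi>. \<pi> permutes {1..n}}. decr_rearr n x k \<le> Z \<pi>}) =
      (\<Sum>\<pi> | \<pi> permutes {1..n}. of_bool (decr_rearr n x k \<le> Z \<pi>))"
    using fin by (simp add: of_bool_def sum.If_cases Int_def)
  finally show ?thesis by simp
qed

text \<open>Abel summation with respect to the increments \<open>d k = f (y k) - f (y (k + 1))\<close>.\<close>

lemma sum_antimono_tails_le:
  fixes y :: "nat \<Rightarrow> real"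
  assumes anti: "\<And>k m. 1 \<le> k \<Longrightarrow> k \<le> m \<Longrightarrow> m \<le> n \<Longrightarrow> y m \<le> y k"
    and c: "0 \<le> c" and f: "\<And>u v. 0 \<le> u \<Longrightarrow> u \<le> v \<Longrightarrow> f u \<le> f v" "\<And>u. 0 \<le> u \<Longrightarrow> 0 \<le> f u"
    and y0: "\<And>k. 1 \<le> k \<Longrightarrow> k \<le> n \<Longrightarrow> 0 \<le> y k" and Z0: "\<And>\<pi>. 0 \<le> Z \<pi>"
    and tails: "\<And>k. 1 \<le> k \<Longrightarrow> k \<le> n \<Longrightarrow> real k \<le> c * (\<Sum>\<pi>\<in>P. of_bool (y k \<le> Z \<pi>))"
  shows "(\<Sum>k=1..n. f (y k)) \<le> c * (\<Sum>\<pi>\<in>P. f (Z \<pi>) :: real)"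
proof -
  \<comment> \<open>The value 0 past \<open>n\<close> makes the last increment equal to
    \<open>f (y n)\<close>, so the increments from \<open>k\<close> on telescope to
    \<open>f (y k)\<close>.\<close>
  define w where "w k = (if k \<le> n then f (y k) else 0)" for k
  define d where "d k = w k - w (Suc k)" for k
  have d0: "0 \<le> d k" if "k \<in> {1..n}" for k
    using that anti[of k "Suc k"] y0[of "Suc k"] y0[of k] f by (auto simp: d_def w_def)
  have tele: "(\<Sum>j=k..n. d j) = f (y k)" if "1 \<le> k" "k \<le> n" for k
    using sum_Suc_diff[of k n "\<lambda>i. - w i"] that by (simp add: d_def w_def)
  have "(\<Sum>k=1..n. f (y k)) = (\<Sum>k=1..n. \<Sum>j=1..n. of_bool (k \<le> j) * d j)"
  proof (rule sum.cong[OF refl])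
    fix k assume k: "k \<in> {1..n}"
    have "f (y k) = (\<Sum>j=k..n. d j)" using k tele by simp
    also have "\<dots> = (\<Sum>j=1..n. of_bool (k \<le> j) * d j)"
      using k by (intro sum.mono_neutral_cong_left) auto
    finally show "f (y k) = (\<Sum>j=1..n. of_bool (k \<le> j) * d j)" .
  qed
  also have "\<dots> = (\<Sum>j=1..n. \<Sum>k=1..n. of_bool (k \<le> j) * d j)" by (rule sum.swap)
  also have "\<dots> = (\<Sum>j=1..n. real j * d j)"
  proof (rule sum.cong[OF refl])
    fix j assume j: "j \<in> {1..n}"
    then have "{1..n} \<inter> {k. k \<le> j} = {1..j}" by auto
    then show "(\<Sum>k=1..n. of_bool (k \<le> j) * d j) = real j * d j"
      by (simp add: of_bool_def sum.If_cases flip: sum_distrib_right)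
  qed
  also have "\<dots> \<le> (\<Sum>j=1..n. (c * (\<Sum>\<pi>\<in>P. of_bool (y j \<le> Z \<pi>))) * d j)"
    using tails d0 by (intro sum_mono mult_right_mono) auto
  also have "\<dots> = c * (\<Sum>j=1..n. \<Sum>\<pi>\<in>P. of_bool (y j \<le> Z \<pi>) * d j)"
    by (simp only: sum_distrib_left sum_distrib_right mult.assoc)
  also have "(\<Sum>j=1..n. \<Sum>\<pi>\<in>P. of_bool (y j \<le> Z \<pi>) * d j) = (\<Sum>\<pi>\<in>P. \<Sum>j=1..n. of_bool (y j \<le> Z \<pi>) * d j)"
    by (rule sum.swap)
  also have "c * \<dots> \<le> c * (\<Sum>\<pi>\<in>P. f (Z \<pi>))"
  proof (intro mult_left_mono sum_mono c)
    fix \<pi>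
    define J where "J = {j \<in> {1..n}. y j \<le> Z \<pi>}"
    have fin: "finite J" by (simp add: J_def)
    have "(\<Sum>j=1..n. of_bool (y j \<le> Z \<pi>) * d j) = (\<Sum>j\<in>J. d j)"
      by (rule sum.mono_neutral_cong_right) (auto simp: J_def)
    also have "\<dots> \<le> f (Z \<pi>)"
    proof (cases "J = {}")
      case True
      then show ?thesis using f(2) Z0 by simp
    next
      case False
      define k where "k = Min J"
      have k: "k \<in> J" using fin False by (simp add: k_def)
      \<comment> \<open>Since \<open>y\<close> is nonincreasing, the indices with
        \<open>y j \<le> Z \<pi>\<close> form a final segment.\<close>
      have "J = {k..n}"
      proof (intro set_eqI iffI)
        fix j assume "j \<in> {k..n}"
        then show "j \<in> J" using k anti[of k j] by (auto simp: J_def)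
      qed (use fin in \<open>auto simp: k_def J_def\<close>)
      moreover have "1 \<le> k" "k \<le> n" using k by (auto simp: J_def)
      ultimately have "(\<Sum>j\<in>J. d j) = f (y k)" using tele by simp
      also have "\<dots> \<le> f (Z \<pi>)" using k y0 by (intro f) (auto simp: J_def)
      finally show ?thesis .
    qed
    finally show "(\<Sum>j=1..n. of_bool (y j \<le> Z \<pi>) * d j) \<le> f (Z \<pi>)" .
  qed
  finally show ?thesis .
qed

text \<open>Domination of tails up to \<open>hit_const\<close> passes to means of nondecreasing
  functions; used with \<open>f u = M (u / \<theta>)\<close> to compare modulars.\<close>

lemma mean_decr_rearr_le:
  assumes n: "1 \<le> n"
    and f: "\<And>u v. 0 \<le> u \<Longrightarrow> u \<le> v \<Longrightarrow> f u \<le> f v" "\<And>u. 0 \<le> u \<Longrightarrow> 0 \<le> f u"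
    and Z: "\<And>\<pi> i. i \<in> {1..n} \<Longrightarrow> \<bar>x i (\<pi> i)\<bar> \<le> Z \<pi>"
  shows "(\<Sum>k=1..n. f (decr_rearr n x k)) / n \<le> hit_const * ((\<Sum>\<pi> | \<pi> permutes {1..n}. f (Z \<pi>)) / fact n)"
proof -
  have nn: "n \<le> n\<^sup>2" by (simp add: power2_eq_square)
  have Z0: "0 \<le> Z \<pi>" for \<pi> using Z[of 1 \<pi>] n by fastforce
  have "(\<Sum>k=1..n. f (decr_rearr n x k)) \<le> (n * hit_const / fact n) * (\<Sum>\<pi> | \<pi> permutes {1..n}. f (Z \<pi>))"
  proof (rule sum_antimono_tails_le[OF _ _ f])
    show "0 \<le> real n * hit_const / fact n" using hit_const_ge by simp
    show "real k \<le> real n * hit_const / fact n * (\<Sum>\<pi> | \<pi> permutes {1..n}. of_bool (decr_rearr n x k \<le> Z \<pi>))"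
      if "1 \<le> k" "k \<le> n" for k
    proof -
      have "real k / n \<le> hit_const * ((\<Sum>\<pi> | \<pi> permutes {1..n}. of_bool (decr_rearr n x k \<le> Z \<pi>)) / fact n)"
        by (rule tail_probability[OF n that]) (rule Z)
      then show ?thesis using n by (simp add: pos_divide_le_eq mult_ac)
    qed
  qed (use nn Z0 in \<open>auto intro: decr_rearr_antimono decr_rearr_nonneg\<close>)
  then show ?thesis using n by (simp add: field_simps)
qed

subsection \<open>The two-sided estimate and its failure\<close>

lemma modular_T_op:
  assumes "orlicz M" "bij_betw l {\<pi>. \<pi> permutes {1..n}} {1..fact n}" "0 < r"
  shows "orlicz_modular M (\<lambda>t. T_op q n l x t / r) =
    ennreal ((\<Sum>\<pi> | \<pi> permutes {1..n}. M (T_val q n x \<pi> / r)) / fact n)"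
  using orlicz.T_op_modular(1)[OF assms] by (simp add: T_val_def)

lemma modular_U_op:
  assumes "orlicz M" "1 \<le> n" "0 < r"
  shows "orlicz_modular M (\<lambda>t. U_op n x t / r) = ennreal ((\<Sum>k=1..n. M (decr_rearr n x k / r)) / n)"
proof -
  have "n \<le> n\<^sup>2" by (simp add: power2_eq_square)
  then have "\<bar>decr_rearr n x k\<bar> = decr_rearr n x k" if "k \<in> {1..n}" for k
    using that decr_rearr_nonneg[of k n x] by simp
  then show ?thesis
    using orlicz.U_op_modular(1)[OF assms(1) _ assms(3), of n x] assms(2) by simp
qed

lemma sum_permutes_le_of_mean:
  fixes f g :: "(nat \<Rightarrow> nat) \<Rightarrow> real"
  assumes "\<And>\<pi>. f \<pi> \<le> c * (1 + g \<pi>)" "(\<Sum>\<pi> | \<pi> permutes {1..n}. g \<pi>) / fact n \<le> m" "0 \<le> c"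
  shows "(\<Sum>\<pi> | \<pi> permutes {1..n}. f \<pi>) / fact n \<le> c * (1 + m)"
proof -
  have "(\<Sum>\<pi> | \<pi> permutes {1..n}. f \<pi>) / fact n \<le> (\<Sum>\<pi> | \<pi> permutes {1..n}. c * (1 + g \<pi>)) / fact n"
    by (intro divide_right_mono sum_mono assms) auto
  also have "\<dots> = c * (1 + (\<Sum>\<pi> | \<pi> permutes {1..n}. g \<pi>) / fact n)"
    by (simp add: sum.distrib card_permutations add_divide_distrib distrib_left flip: sum_distrib_left)
  also have "\<dots> \<le> c * (1 + m)" using assms by (intro mult_left_mono) auto
  finally show ?thesis .
qed

lemma T_op_upper:
  assumes q: "1 \<le> q" and pq: "0 < p" "p < q" and M: "generates_exp_L p M"
  shows "\<exists>C>0. \<forall>n\<ge>1. \<forall>l x. bij_betw l {\<pi>. \<pi> permutes {1..n}} {1..fact n} \<longrightarrow>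
    fnorm (orlicz_space M) (T_op q n l x) \<le> C * (fnorm (orlicz_space M) (U_op n x) +
      ((\<Sum>k=n+1..n\<^sup>2. decr_rearr n x k powr q) / real n) powr (1 / q))"
proof -
  interpret orlicz M by (rule generates_exp_L_bounds(1)[OF pq(1) M])
  have orl: "orlicz M" by unfold_locales
  obtain a b K where ab: "0 < a" "a \<le> 1" "0 < b" "0 \<le> K"
    and lo: "\<And>u. 0 \<le> u \<Longrightarrow> exp ((a * u) powr p) - 1 \<le> K + M u"
    and up: "\<And>u. 0 \<le> u \<Longrightarrow> M u \<le> exp ((b * u) powr p) + K"
    using generates_exp_L_bounds(2)[OF pq(1) M] by auto
  obtain D' where D': "D' > 0" "\<And>u. 0 \<le> u \<Longrightarrow> u \<le> D' * (1 + M u)" using linear_le_M by blast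
  \<comment> \<open>A bound for every \<open>u\<close> with \<open>M u \<le> 1\<close>. It is
    applied to the \<open>n\<close>-th largest entry over \<open>\<theta>\<close>, whose
    \<open>M\<close>-value is at most the mean over the \<open>n\<close> largest.\<close>
  define D where "D = max 1 (2 * D')"
  have D: "1 \<le> D" by (simp add: D_def)
  have DM: "u \<le> D" if "0 \<le> u" "M u \<le> 1" for u
  proof -
    have "u \<le> D' * (1 + M u)" using that by (intro D')
    also have "\<dots> \<le> D' * 2" using that D' by (intro mult_left_mono) auto
    finally show ?thesis by (simp add: D_def)
  qed
  \<comment> \<open>\<open>K + 1\<close> is the constant obtained for \<open>top\<close>:
    \<open>K\<close> from \<open>lo\<close>, 1 from the modular of \<open>U_op\<close>. The last
    \<open>K\<close> comes from \<open>up\<close>.\<close>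
  define K' where "K' = exp (1 + exp 1 * ((K + 1) + 2)) + K"
  have K': "1 \<le> K'"
  proof -
    have "0 \<le> 1 + exp 1 * ((K + 1) + 2)" using ab by (intro add_nonneg_nonneg mult_nonneg_nonneg) auto
    then have "1 \<le> exp (1 + exp 1 * ((K + 1) + 2))" by simp
    then show ?thesis using ab by (simp only: K'_def)
  qed
  \<comment> \<open>Three losses: \<open>K'\<close> from modular to norm, \<open>b / a\<close> from
    the two scales at which \<open>M\<close> is compared with exponentials, \<open>D\<close> from
    bounding \<open>L\<close> by \<open>\<nu> + \<theta>\<close>.\<close>
  define C where "C = K' * b / a * D"
  have C: "C > 0" using K' ab D by (simp add: C_def)
  have "fnorm E (T_op q n l x) \<le> C * (fnorm E (U_op n x) + \<nu>)"
    if n: "1 \<le> n" and l: "bij_betw l {\<pi>. \<pi> permutes {1..n}} {1..fact n}"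
      and \<nu>: "\<nu> = ((\<Sum>k=n+1..n\<^sup>2. decr_rearr n x k powr q) / real n) powr (1 / q)" for n l x \<nu>
  proof -
    let ?y = "decr_rearr n x"
    have ny: "n \<le> n\<^sup>2" by (simp add: power2_eq_square)
    have y0: "0 \<le> ?y k" if "k \<in> {1..n}" for k using that ny by (intro decr_rearr_nonneg) auto
    have U: "U_op n x \<in> elems E" using n U_op_modular(2)[of n 1 x] by simp
    have "\<nu> \<ge> 0" by (simp add: \<nu>)
    have main: "fnorm E (T_op q n l x) \<le> C * (\<nu> + \<theta>)" if \<theta>: "fnorm E (U_op n x) < \<theta>" for \<theta>
    proof -
      note r = modular_le_of_norm_less[OF U \<theta>]
      \<comment> \<open>Large enough to dominate \<open>\<theta>\<close>, the \<open>n\<close>-th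
        largest entry and \<open>\<nu>\<close>, which give \<open>top\<close>, \<open>mid\<close>
        and \<open>rest\<close> of \<open>exp_moment_T_val\<close>.\<close>
      define L where "L = \<nu> + D * \<theta>"
      have L: "L > 0" "\<theta> \<le> L" "\<nu> \<le> L"
      proof -
        have "1 * \<theta> \<le> D * \<theta>" using r(1) D by (intro mult_right_mono) auto
        then show "L > 0" "\<theta> \<le> L" "\<nu> \<le> L" using r(1) \<open>\<nu> \<ge> 0\<close> unfolding L_def by linarith+
      qed
      have mean: "(\<Sum>k=1..n. M (?y k / \<theta>)) \<le> n"
        using r(2) n unfolding modular_U_op[OF orl n r(1)] by (simp add: ennreal_le_1 divide_le_eq)
      have "real n * M (?y n / \<theta>) = (\<Sum>k=1..n. M (?y n / \<theta>))" by simp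
      also have "\<dots> \<le> (\<Sum>k=1..n. M (?y k / \<theta>))"
        using r(1) n ny y0[of n] by (intro sum_mono M_mono divide_right_mono decr_rearr_antimono) auto
      finally have "real n * M (?y n / \<theta>) \<le> real n * 1" using mean by linarith
      then have "M (?y n / \<theta>) \<le> 1" by (rule mult_left_le_imp_le) (use n in simp)
      then have "?y n / \<theta> \<le> D" using y0[of n] n r(1) by (intro DM) auto
      then have mid: "?y n \<le> L" using r(1) \<open>\<nu> \<ge> 0\<close> by (simp add: pos_divide_le_eq L_def)
      have top: "(\<Sum>k=1..n. exp ((a * ?y k / L) powr p) - 1) \<le> real n * (K + 1)"
      proof -
        have "(\<Sum>k=1..n. exp ((a * ?y k / L) powr p) - 1) \<le> (\<Sum>k=1..n. K + M (?y k / \<theta>))"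
        proof (rule sum_mono)
          fix k assume k: "k \<in> {1..n}"
          have "(a * ?y k / L) powr p \<le> (a * (?y k / \<theta>)) powr p"
            using y0[OF k] L r(1) ab pq by (intro powr_mono2) (auto intro!: divide_left_mono)
          then have "exp ((a * ?y k / L) powr p) - 1 \<le> exp ((a * (?y k / \<theta>)) powr p) - 1" by simp
          also have "\<dots> \<le> K + M (?y k / \<theta>)" using y0[OF k] r(1) by (intro lo) auto
          finally show "exp ((a * ?y k / L) powr p) - 1 \<le> K + M (?y k / \<theta>)" .
        qed
        also have "\<dots> \<le> real n * (K + 1)" using mean by (simp add: sum.distrib algebra_simps)
        finally show ?thesis .
      qed
      have sum0: "0 \<le> (\<Sum>k=n+1..n\<^sup>2. ?y k powr q)" by (simp add: sum_nonneg)
      have "(\<Sum>k=n+1..n\<^sup>2. ?y k powr q) = real n * \<nu> powr q"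
        using n q sum0 by (simp add: \<nu> powr_powr)
      also have "\<dots> \<le> real n * L powr q"
        using L q \<open>\<nu> \<ge> 0\<close> by (intro mult_left_mono powr_mono2) auto
      finally have rest: "(\<Sum>k=n+1..n\<^sup>2. ?y k powr q) \<le> real n * L powr q" .
      note mom = exp_moment_T_val[OF pq n L(1) ab(1,2) top mid rest]
      \<comment> \<open>Chosen so that \<open>up\<close> at this scale produces the exponential
        whose mean has just been bounded.\<close>
      define \<rho> where "\<rho> = L * b / a"
      have \<rho>: "\<rho> > 0" using L ab by (simp add: \<rho>_def)
      have "(\<Sum>\<pi> | \<pi> permutes {1..n}. M (T_val q n x \<pi> / \<rho>)) / fact n \<le>
          (\<Sum>\<pi> | \<pi> permutes {1..n}. exp ((a * T_val q n x \<pi> / L) powr p) + K) / fact n"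
      proof (intro divide_right_mono sum_mono)
        fix \<pi>
        have "b * (T_val q n x \<pi> / \<rho>) = a * T_val q n x \<pi> / L" using ab L by (simp add: \<rho>_def)
        then show "M (T_val q n x \<pi> / \<rho>) \<le> exp ((a * T_val q n x \<pi> / L) powr p) + K"
          using up[of "T_val q n x \<pi> / \<rho>"] \<rho> T_val_nonneg[of q n x \<pi>] by simp
      qed simp
      also have "\<dots> = (\<Sum>\<pi> | \<pi> permutes {1..n}. exp ((a * T_val q n x \<pi> / L) powr p)) / fact n + K"
        by (simp add: sum.distrib card_permutations add_divide_distrib)
      also have "\<dots> \<le> K'" using mom by (simp add: K'_def)
      finally have "modular (\<lambda>t. T_op q n l x t / \<rho>) \<le> ennreal K'"
        unfolding modular_T_op[OF orl l \<rho>] by (rule ennreal_leI)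
      then have "fnorm E (T_op q n l x) \<le> K' * \<rho>"
        using T_op_modular(2)[OF l \<rho>, of q x] by (intro elems_norm_le(2)[OF _ \<rho> K'] elems_measurable)
      also have "\<dots> = K' * b / a * L" by (simp add: \<rho>_def)
      also have "\<dots> \<le> K' * b / a * (D * (\<nu> + \<theta>))"
        using K' ab D \<open>\<nu> \<ge> 0\<close> mult_right_mono[of 1 D \<nu>]
        by (intro mult_left_mono) (auto simp: L_def algebra_simps)
      finally show ?thesis by (simp add: C_def mult.assoc)
    qed
    have "fnorm E (T_op q n l x) / C - \<nu> \<le> fnorm E (U_op n x)"
    proof (rule dense_ge)
      fix \<theta> assume "fnorm E (U_op n x) < \<theta>"
      then have "fnorm E (T_op q n l x) / C \<le> \<nu> + \<theta>"
        using main[of \<theta>] C by (simp add: pos_divide_le_eq mult.commute)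
      then show "fnorm E (T_op q n l x) / C - \<nu> \<le> \<theta>" by simp
    qed
    then show ?thesis using C by (simp add: diff_le_eq pos_divide_le_eq mult.commute)
  qed
  then show ?thesis using C by blast
qed

text \<open>Exponentials outgrow powers, and the constant absorbs a bounded range. Hence a modular
  bound controls the \<open>q\<close>-th moment.\<close>

lemma powr_le_M:
  assumes "0 < p" "0 < q" "generates_exp_L p M"
  shows "\<exists>K>0. \<forall>u\<ge>0. u powr q \<le> K * (1 + M u)"
proof -
  interpret orlicz M by (rule generates_exp_L_bounds(1)[OF assms(1,3)])
  obtain a b K where ab: "0 < a" "0 \<le> K"
    and lo: "\<And>u. 0 \<le> u \<Longrightarrow> exp ((a * u) powr p) - 1 \<le> K + M u"
    using generates_exp_L_bounds(2)[OF assms(1,3)] by auto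
  have "eventually (\<lambda>u. u powr q \<le> exp ((a * u) powr p)) at_top"
    using assms ab by real_asymp
  then obtain v where v: "\<And>u. u \<ge> v \<Longrightarrow> u powr q \<le> exp ((a * u) powr p)"
    by (auto simp: eventually_at_top_linorder)
  define w where "w = max 0 v"
  define C where "C = 1 + K + w powr q"
  have C: "1 + K \<le> C" "w powr q \<le> C" "1 \<le> C" using ab by (auto simp: C_def)
  have "u powr q \<le> C * (1 + M u)" if u: "0 \<le> u" for u
  proof (cases "u \<ge> v")
    case True
    have "u powr q \<le> 1 + K + M u" using v[OF True] lo[OF u] by simp
    also have "\<dots> \<le> C + C * M u" using C mult_right_mono[of 1 C "M u"] M_nonneg[OF u] by simp
    finally show ?thesis by (simp add: algebra_simps)
  next
    case False
    then have "u powr q \<le> w powr q" using u assms by (intro powr_mono2) (auto simp: w_def)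
    also have "\<dots> \<le> C * 1" using C by simp
    also have "\<dots> \<le> C * (1 + M u)" using C M_nonneg[OF u] by (intro mult_left_mono) auto
    finally show ?thesis .
  qed
  then show ?thesis using C by (intro exI[of _ C]) auto
qed

text \<open>Holds for \<open>p\<close> and \<open>q\<close> in any order, so for
  \<open>q < p\<close> it is the upper estimate that fails.\<close>

lemma T_op_lower:
  assumes q: "1 \<le> q" and p: "0 < p" and M: "generates_exp_L p M"
  shows "\<exists>c>0. \<forall>n\<ge>1. \<forall>l x. bij_betw l {\<pi>. \<pi> permutes {1..n}} {1..fact n} \<longrightarrow>
    c * (fnorm (orlicz_space M) (U_op n x) +
      ((\<Sum>k=n+1..n\<^sup>2. decr_rearr n x k powr q) / real n) powr (1 / q))
    \<le> fnorm (orlicz_space M) (T_op q n l x)"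
proof -
  interpret orlicz M by (rule generates_exp_L_bounds(1)[OF p M])
  have orl: "orlicz M" by unfold_locales
  have q0: "0 < q" using q by simp
  obtain K where K: "K > 0" "\<And>u. 0 \<le> u \<Longrightarrow> u powr q \<le> K * (1 + M u)"
    using powr_le_M[OF p q0 M] by blast
  \<comment> \<open>The first summand accounts for \<open>U_op\<close>, the second for the
    normalised sum over the remaining entries.\<close>
  define C where "C = hit_const + (2 * K) powr (1 / q)"
  have C: "C > 0" using hit_const_ge by (simp add: C_def add_pos_nonneg)
  have "1 / C * (fnorm E (U_op n x) + \<nu>) \<le> fnorm E (T_op q n l x)"
    if n: "1 \<le> n" and l: "bij_betw l {\<pi>. \<pi> permutes {1..n}} {1..fact n}"
      and \<nu>: "\<nu> = ((\<Sum>k=n+1..n\<^sup>2. decr_rearr n x k powr q) / real n) powr (1 / q)" for n l x \<nu>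
  proof -
    let ?y = "decr_rearr n x"
    have T: "T_op q n l x \<in> elems E" using T_op_modular(2)[OF l, of 1] by simp
    have U: "U_op n x \<in> elems E" using n U_op_modular(2)[of n 1 x] by simp
    have main: "fnorm E (U_op n x) + \<nu> \<le> C * \<theta>" if \<theta>: "fnorm E (T_op q n l x) < \<theta>" for \<theta>
    proof -
      note r = modular_le_of_norm_less[OF T \<theta>]
      have mean: "(\<Sum>\<pi> | \<pi> permutes {1..n}. M (T_val q n x \<pi> / \<theta>)) / fact n \<le> 1"
        using r(2) unfolding modular_T_op[OF orl l r(1)] by (simp add: ennreal_le_1)
      have "(\<Sum>k=1..n. M (?y k / \<theta>)) / n \<le>
          hit_const * ((\<Sum>\<pi> | \<pi> permutes {1..n}. M (T_val q n x \<pi> / \<theta>)) / fact n)"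
        using n r(1) q by (intro mean_decr_rearr_le[where f="\<lambda>u. M (u / \<theta>)"])
          (auto intro!: M_mono M_nonneg divide_right_mono entry_le_T_val)
      also have "\<dots> \<le> hit_const * 1" using mean hit_const_ge by (intro mult_left_mono) auto
      finally have "modular (\<lambda>t. U_op n x t / \<theta>) \<le> ennreal hit_const"
        unfolding modular_U_op[OF orl n r(1)] by (intro ennreal_leI) simp
      then have 1: "fnorm E (U_op n x) \<le> hit_const * \<theta>"
        using U hit_const_ge by (intro elems_norm_le(2)[OF _ r(1)] elems_measurable) auto
      \<comment> \<open>The mean of \<open>1 + M\<close> is at most 2, which bounds the
        \<open>q\<close>-th moment; the next step computes the same moment exactly from the
        entries.\<close>
      have "(\<Sum>\<pi> | \<pi> permutes {1..n}. (T_val q n x \<pi> / \<theta>) powr q) / fact n \<le> K * (1 + 1)"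
        using K T_val_nonneg r(1) mean by (intro sum_permutes_le_of_mean[OF _ mean]) auto
      moreover have "(\<Sum>\<pi> | \<pi> permutes {1..n}. (T_val q n x \<pi> / \<theta>) powr q) / fact n =
          ((\<Sum>k=1..n\<^sup>2. ?y k powr q) / n) / \<theta> powr q"
      proof -
        have "(\<Sum>\<pi> | \<pi> permutes {1..n}. (T_val q n x \<pi> / \<theta>) powr q) / fact n =
            ((\<Sum>\<pi> | \<pi> permutes {1..n}. \<Sum>i\<in>{1..n}. \<bar>x i (\<pi> i)\<bar> powr q) / fact (card {1..n})) / \<theta> powr q"
          using r(1) q by (simp add: powr_divide T_val_nonneg T_val_powr sum_divide_distrib mult.commute)
        also have "(\<Sum>\<pi> | \<pi> permutes {1..n}. \<Sum>i\<in>{1..n}. \<bar>x i (\<pi> i)\<bar> powr q) / fact (card {1..n}) =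
            (\<Sum>i\<in>{1..n}. \<Sum>j\<in>{1..n}. \<bar>x i j\<bar> powr q) / card {1..n}"
          by (rule sum_permutes_sum) simp
        also have "(\<Sum>i\<in>{1..n}. \<Sum>j\<in>{1..n}. \<bar>x i j\<bar> powr q) = (\<Sum>k=1..n\<^sup>2. ?y k powr q)"
          by (rule sum_decr_rearr[symmetric])
        finally show ?thesis by simp
      qed
      ultimately have "((\<Sum>k=1..n\<^sup>2. ?y k powr q) / n) / \<theta> powr q \<le> K * (1 + 1)"
        by (simp only:)
      then have "(\<Sum>k=1..n\<^sup>2. ?y k powr q) / n \<le> K * (1 + 1) * \<theta> powr q"
        using r(1) by (subst (asm) pos_divide_le_eq) auto
      then have "(\<Sum>k=1..n\<^sup>2. ?y k powr q) / n \<le> 2 * K * \<theta> powr q"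
        by (simp add: mult.commute)
      moreover have "(\<Sum>k=n+1..n\<^sup>2. ?y k powr q) \<le> (\<Sum>k=1..n\<^sup>2. ?y k powr q)"
        by (intro sum_mono2) auto
      ultimately have "(\<Sum>k=n+1..n\<^sup>2. ?y k powr q) / n \<le> 2 * K * \<theta> powr q"
        by (meson divide_right_mono of_nat_0_le_iff order_trans)
      then have "\<nu> \<le> (2 * K * \<theta> powr q) powr (1 / q)"
        unfolding \<nu> using q by (intro powr_mono2) (auto intro!: divide_nonneg_nonneg sum_nonneg)
      also have "\<dots> = (2 * K) powr (1 / q) * \<theta>"
        using q K r(1) by (simp add: powr_mult powr_powr)
      finally show ?thesis using 1 by (simp add: C_def algebra_simps)
    qed
    show ?thesis
    proof (rule dense_ge)
      fix \<theta> assume "fnorm E (T_op q n l x) < \<theta>"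
      then show "1 / C * (fnorm E (U_op n x) + \<nu>) \<le> \<theta>"
        using main[of \<theta>] C by (simp add: pos_divide_le_eq mult.commute)
    qed
  qed
  moreover have "1 / C > 0" using C by simp
  ultimately show ?thesis by blast
qed

text \<open>The identity matrix is a counterexample for \<open>q < p\<close>: there \<open>U_op\<close> is \<open>1\<close> almost
  everywhere, but the identity permutation, of probability \<open>1 / fact n\<close>, contributes the value
  \<open>n powr (1 / q)\<close> to \<open>T_op\<close>, and \<open>exp (n powr (p / q))\<close> outgrows \<open>fact n\<close>.\<close>

lemma not_F_class:
  assumes q: "1 \<le> q" and pq: "q < p" and M: "generates_exp_L p M"
  shows "orlicz_space M \<notin> F_class q"
proof
  assume "orlicz_space M \<in> F_class q"
  have p0: "0 < p" using q pq by simp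
  interpret orlicz M by (rule generates_exp_L_bounds(1)[OF p0 M])
  have orl: "orlicz M" by unfold_locales
  \<comment> \<open>\<open>1 \<le> q < p\<close> puts \<open>p\<close> in the convex range, where
    \<open>M\<close> is \<open>M_exp p\<close> itself.\<close>
  have ME: "M = M_exp p" using M q pq by (simp add: generates_exp_L_def)
  obtain C where C: "C > 0" and bound: "\<And>n l x. 1 \<le> n \<Longrightarrow>
      bij_betw l {\<pi>. \<pi> permutes {1..n}} {1..fact n} \<Longrightarrow> fnorm E (T_op q n l x) \<le> C * (fnorm E (U_op n x) +
        ((\<Sum>k=n+1..n\<^sup>2. decr_rearr n x k powr q) / real n) powr (1 / q))"
    using \<open>orlicz_space M \<in> F_class q\<close> unfolding F_class_def Let_def by blast
  \<comment> \<open>For the identity matrix the upper estimate gives at most \<open>3 * C\<close>: 2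
    from \<open>U_op\<close> and 1 from the remaining entries. The extra 1 puts
    \<open>\<theta>\<close> strictly above the norm.\<close>
  define \<theta> where "\<theta> = 3 * C + 1"
  have \<theta>: "\<theta> > 0" using C by (simp add: \<theta>_def)
  define x :: "nat \<Rightarrow> nat \<Rightarrow> real" where "x i j = of_bool (i = j)" for i j
  define s where "s = p / q"
  have s: "s > 1" using q pq by (simp add: s_def)
  define B where "B = \<theta> powr p"
  have B: "B > 0" using \<theta> by (simp add: B_def)
  \<comment> \<open>After exponentiation the right side is \<open>exp 1 * n ^ n\<close>, which is at
    least \<open>1 + fact n\<close>.\<close>
  have growth: "eventually (\<lambda>u::real. u powr s / B > 1 + u * ln u) at_top"
    using s B by real_asymp
  have "eventually (\<lambda>n. real n powr s / B > 1 + real n * ln (real n)) sequentially"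
    using eventually_compose_filterlim[OF growth filterlim_real_sequentially] .
  then obtain n where n: "n \<ge> 1" and big: "real n powr s / B > 1 + real n * ln (real n)"
    using eventually_conj[OF eventually_ge_at_top[of 1]] eventually_happens by force
  let ?P = "{\<pi>. \<pi> permutes {1..n}}"
  have fin: "finite ?P" by (intro finite_permutations) simp
  have "card ?P = fact n" by (rule card_permutations) auto
  then obtain l :: "(nat \<Rightarrow> nat) \<Rightarrow> nat" where l: "bij_betw l ?P {1..fact n}"
    using finite_same_card_bij[OF fin, of "{1..fact n :: nat}"] by auto
  have ny: "n \<le> n\<^sup>2" by (simp add: power2_eq_square)
  have y: "0 \<le> decr_rearr n x k" "decr_rearr n x k \<le> 1" if "k \<in> {1..n\<^sup>2}" for k
    using decr_rearr_in[of k n x] that by (auto simp: x_def)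
  \<comment> \<open>\<open>M 1 = exp 1 - 1 \<le> 2\<close> bounds the modular at scale 1, and
    \<open>elems_norm_le\<close> turns this into the factor 2.\<close>
  have "fnorm E (U_op n x) \<le> 2 * 1"
  proof (rule elems_norm_le(2))
    have "(\<Sum>k=1..n. M (decr_rearr n x k / 1)) \<le> (\<Sum>k=1..n. 2)"
    proof (rule sum_mono)
      fix k assume "k \<in> {1..n}"
      then have "M (decr_rearr n x k / 1) \<le> M 1" using y[of k] ny by (intro M_mono) auto
      also have "\<dots> \<le> 2" using exp_le by (simp add: ME M_exp_def)
      finally show "M (decr_rearr n x k / 1) \<le> 2" .
    qed
    then show "modular (\<lambda>t. U_op n x t / 1) \<le> ennreal 2"
      using n unfolding modular_U_op[OF orl n zero_less_one]
      by (intro ennreal_leI) (simp add: pos_divide_le_eq)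
  qed (use n U_op_modular(2)[of n 1 x] in \<open>auto intro: elems_measurable\<close>)
  \<comment> \<open>The quantity is in fact 0, but bounding its sum by that over all entries, which
    is \<open>n\<close>, suffices.\<close>
  moreover have "((\<Sum>k=n+1..n\<^sup>2. decr_rearr n x k powr q) / real n) powr (1 / q) \<le> 1"
  proof -
    have "(\<Sum>k=n+1..n\<^sup>2. decr_rearr n x k powr q) \<le> (\<Sum>k=1..n\<^sup>2. decr_rearr n x k powr q)"
      by (intro sum_mono2) auto
    also have "\<dots> = (\<Sum>i=1..n. \<Sum>j=1..n. \<bar>x i j\<bar> powr q)"
      by (rule sum_decr_rearr)
    also have "\<dots> = (\<Sum>i=1..n. \<Sum>j=1..n. of_bool (i = j))"
      using q by (intro sum.cong refl) (auto simp: x_def)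
    also have "\<dots> = n" by (simp add: of_bool_def sum.delta)
    finally have "(\<Sum>k=n+1..n\<^sup>2. decr_rearr n x k powr q) / n \<le> 1"
      using n by (simp add: pos_divide_le_eq)
    moreover have "0 \<le> (\<Sum>k=n+1..n\<^sup>2. decr_rearr n x k powr q) / n"
      by (intro divide_nonneg_nonneg sum_nonneg) auto
    ultimately show ?thesis using q powr_le1[of "1 / q"] by auto
  qed
  ultimately have "C * (fnorm E (U_op n x) +
      ((\<Sum>k=n+1..n\<^sup>2. decr_rearr n x k powr q) / real n) powr (1 / q)) \<le> C * 3"
    using C by (intro mult_left_mono) auto
  with bound[OF n l, of x] have "fnorm E (T_op q n l x) < \<theta>" by (simp add: \<theta>_def)
  then have "modular (\<lambda>t. T_op q n l x t / \<theta>) \<le> 1"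
    using T_op_modular(2)[OF l zero_less_one, of q x] by (intro modular_le_of_norm_less(2))
  then have "(\<Sum>\<pi>\<in>?P. M (T_val q n x \<pi> / \<theta>)) \<le> fact n"
    unfolding modular_T_op[OF orl l \<theta>] by (simp add: ennreal_le_1 pos_divide_le_eq)
  moreover have "M (T_val q n x id / \<theta>) \<le> (\<Sum>\<pi>\<in>?P. M (T_val q n x \<pi> / \<theta>))"
  proof (rule member_le_sum[OF _ _ fin])
    show "id \<in> ?P" by (simp only: mem_Collect_eq permutes_id)
  qed (use \<theta> in \<open>auto intro!: M_nonneg divide_nonneg_pos T_val_nonneg\<close>)
  ultimately have "M (T_val q n x id / \<theta>) \<le> fact n" by linarith
  moreover have "T_val q n x id = real n powr (1 / q)" by (simp add: T_val_def x_def)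
  ultimately have "exp ((real n powr (1 / q) / \<theta>) powr p) \<le> 1 + fact n"
    using \<theta> by (simp add: ME M_exp_def)
  also have "(real n powr (1 / q) / \<theta>) powr p = real n powr s / B"
    using \<theta> by (simp add: powr_divide powr_powr s_def B_def)
  also have "1 + fact n \<le> 2 * real n ^ n"
  proof -
    have "fact n \<le> real n ^ n" using fact_le_power[of n] by (simp add: fact_le_power)
    moreover have "1 \<le> real n ^ n" using n by simp
    ultimately show ?thesis by linarith
  qed
  also have "real n ^ n = exp (real n * ln (real n))"
    using n by (simp add: exp_of_nat_mult)
  also have "2 * exp (real n * ln (real n)) \<le> exp 1 * exp (real n * ln (real n))"
    using exp_ge_add_one_self[of 1] by (intro mult_right_mono) auto
  also have "\<dots> = exp (1 + real n * ln (real n))" by (simp add: exp_add)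
  finally show False using big by simp
qed

theorem theorem19:
  fixes p q :: real and M :: "real \<Rightarrow> real"
  assumes "1 \<le> q" and "0 < p" and "generates_exp_L p M"
  shows "(p < q \<longrightarrow> orlicz_space M \<in> F_class q) \<and> (q < p \<longrightarrow> orlicz_space M \<notin> F_class q)"
proof (intro conjI impI)
  assume "q < p"
  then show "orlicz_space M \<notin> F_class q" using assms by (intro not_F_class)
next
  assume "p < q"
  have "ri_space (orlicz_space M)"
    by (rule orlicz.ri_space_orlicz[OF generates_exp_L_bounds(1)[OF assms(2,3)]])
  with T_op_lower[OF assms] T_op_upper[OF assms(1,2) \<open>p < q\<close> assms(3)]
  show "orlicz_space M \<in> F_class q" unfolding F_class_def Let_def by blast
qed

end
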